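(* Let $B=\{n\ge 1:\ \sigma(30n+1)\ge \sigma(30n)\}$. Then $B$ has a natural density $\mathbf{d}B=\lim_{x\to\infty}\frac{\#\{n\le x: n\in B\}}{x}$, and $\mathbf{d}B<0.0371813$.
   Context: For a positive integer $n$, $\sigma(n)$ denotes the sum of all positive divisors of $n$. *)

theory Defs
  imports Complex_Main
begin

definition divisor_sum :: "nat \<Rightarrow> nat" where
  "divisor_sum n = (\<Sum>d | d dvd n. d)"

(* The limit is taken over real x; only positive elements of A are counted. *)
definition has_natural_density :: "nat set \<Rightarrow> real \<Rightarrow> bool" where
  "has_natural_density A \<delta> \<longleftrightarrow>
     ((\<lambda>x::real. real (card {n \<in> A. 1 \<le> n \<and> real n \<le> x}) / x) \<longlongrightarrow> \<delta>) at_top"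

end

theory Submission
  imports Defs "HOL-Number_Theory.Number_Theory" "HOL-Analysis.Harmonic_Numbers" "HOL-Real_Asymp.Real_Asymp"
begin

text \<open>
  Write $h(m) = \sigma(m)/m = \sum_{d \mid m} 1/d$, so that $n \in B$ iff
  $(30n+1)\,h(30n+1) \ge 30n\,h(30n)$.

  Existence of the density: $B$ is approximated by periodic sets. Let $P$ be a finite set of large
  primes and let $M$ be the product of all $d \le y$ coprime to $P$. Apart from $n$ for which $p^2$
  divides $30n$ or $30n+1$ for some $p \in P$, replacing $h(m)$ by
  $h(\gcd(m,M)) \prod_{p \in P,\, p \mid m} (1+1/p)$ costs at most a factor
  $1 + \sum_{d \mid m,\, d > y} 1/d$, which is close to 1 on average. After this truncation the ratio
  $h(30n+1)/h(30n)$ becomes $u(n) v(n)$ with $u$ periodic modulo $M$ and $v$ periodic modulo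
  $\prod P$. The truncation changes membership only if $u(n)v(n)$ is very close to 1. By unique
  factorisation the value $v(n)$ determines which primes of $P$ divide $30n$ and which divide
  $30n+1$, so each value is taken with density at most $\prod_{p \in P} (1-1/p)$. Since $u$ and $v$
  are independent, this also bounds the density of the $n$ with $u(n)v(n)$ close to 1, and it is
  arbitrarily small.

  The bound: $h(30n) \ge h(30) = 12/5$, and $h(30n) \ge h(60) = 14/5$ for even $n$. So Markov's
  inequality is applied to $h(30n+1) - 1$ separately for odd and even $n$; its mean is
  $\sum_{d > 1,\, (d,30) = 1} d^{-2} < 0.0573$ in both cases.
\<close>


subsection \<open>Counting functions and periodic approximation\<close>

text \<open>The integer cutoff makes the limits sequential; \<open>has_natural_density_cnt\<close>
  passes back to real x.\<close>

definition cnt :: "nat set \<Rightarrow> nat \<Rightarrow> nat" where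
  "cnt A N = card (A \<inter> {1..N})"

lemma cnt_le: "cnt A N \<le> N"
proof -
  have "card (A \<inter> {1..N}) \<le> card {1..N}" by (intro card_mono) auto
  thus ?thesis by (simp add: cnt_def)
qed

lemma cnt_mono: "(\<And>n. n \<in> A \<Longrightarrow> 1 \<le> n \<Longrightarrow> n \<le> N \<Longrightarrow> n \<in> B) \<Longrightarrow> cnt A N \<le> cnt B N"
  unfolding cnt_def by (intro card_mono) auto

lemma cnt_Un: "cnt (A \<union> B) N \<le> cnt A N + cnt B N"
  unfolding cnt_def by (metis Int_Un_distrib2 card_Un_le)

definition periodic_set :: "nat \<Rightarrow> nat set \<Rightarrow> bool" where
  "periodic_set L D \<longleftrightarrow> 0 < L \<and> (\<forall>n. n \<in> D \<longleftrightarrow> n mod L \<in> D)"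

text \<open>Moving the window by one step trades \<open>N\<close> for \<open>N + L\<close>, which
  lies in the same residue class.\<close>

lemma card_periodic_window:
  assumes "periodic_set L D"
  shows "card (D \<inter> {N..<N+L}) = card (D \<inter> {..<L})"
proof (induction N)
  case 0
  then show ?case by (simp add: lessThan_atLeast0)
next
  case (Suc N)
  have L: "0 < L" using assms by (simp add: periodic_set_def)
  have iff: "N + L \<in> D \<longleftrightarrow> N \<in> D"
    using assms unfolding periodic_set_def by (metis mod_add_self2)
  have l: "{N..<N+L} = insert N {Suc N..<N+L}" using L by auto
  have r: "{Suc N..<Suc N+L} = insert (N+L) {Suc N..<N+L}" using L by auto
  have "card (D \<inter> {Suc N..<Suc N+L}) = card (D \<inter> {N..<N+L})"
    unfolding l r using iff by (cases "N \<in> D") (auto simp: Int_insert_right)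
  with Suc show ?case by simp
qed

text \<open>Removing a full block of length \<open>L\<close> changes both terms equally, so the
  error is that of an incomplete block, where both terms lie between 0 and
  \<open>N < L\<close>.\<close>

lemma cnt_periodic:
  assumes "periodic_set L D"
  shows "\<bar>real (cnt D N) - real N * real (card (D \<inter> {..<L})) / real L\<bar> \<le> real L"
proof (induction N rule: less_induct)
  case (less N)
  have L: "0 < L" using assms by (simp add: periodic_set_def)
  define r where "r = card (D \<inter> {..<L})"
  have rL: "r \<le> L" unfolding r_def using card_mono[of "{..<L}" "D \<inter> {..<L}"] by simp
  show ?case
  proof (cases "N < L")
    case True
    have "real N * (real r / real L) \<le> real N * 1"
      using rL L by (intro mult_left_mono) auto
    moreover have "0 \<le> real N * real r / real L" by simp
    moreover have "real (cnt D N) \<le> real N" using cnt_le by simp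
    ultimately show ?thesis unfolding r_def[symmetric] using True
      unfolding times_divide_eq_right mult_1_right by linarith
  next
    case False
    define K where "K = N - L"
    have N: "N = K + L" using False K_def by simp
    have "{1..N} = {1..K} \<union> {K+1..<K+1+L}" using N by auto
    hence "cnt D N = card ((D \<inter> {1..K}) \<union> (D \<inter> {K+1..<K+1+L}))"
      unfolding cnt_def by (simp add: Int_Un_distrib)
    also have "\<dots> = cnt D K + card (D \<inter> {K+1..<K+1+L})"
      unfolding cnt_def by (intro card_Un_disjoint) auto
    also have "card (D \<inter> {K+1..<K+1+L}) = r"
      unfolding r_def by (rule card_periodic_window[OF assms])
    finally have "real (cnt D N) - real N * real r / real L = real (cnt D K) - real K * real r / real L"
      using L N by (simp add: field_simps)
    moreover have "K < N" using N L by simp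
    ultimately show ?thesis using less.IH[of K] unfolding r_def by simp
  qed
qed

lemma eventually_const_le_linear:
  assumes "0 < (\<delta>::real)"
  shows "eventually (\<lambda>N::nat. C \<le> \<delta> * real N) sequentially"
  using assms by real_asymp

text \<open>The ratio is eventually within 2\<delta> of the density of \<open>D\<close>, hence
  Cauchy. The limit stays implicit because \<open>D\<close> changes with \<delta>.\<close>

lemma cnt_ratio_convergent:
  assumes approx: "\<And>\<delta>::real. 0 < \<delta> \<Longrightarrow> \<exists>L D E. periodic_set L D \<and>
      (\<forall>n\<ge>1. n \<notin> E \<longrightarrow> (n \<in> B \<longleftrightarrow> n \<in> D)) \<and>
      eventually (\<lambda>N. real (cnt E N) \<le> \<delta> * real N) sequentially"
  shows "convergent (\<lambda>N. real (cnt B N) / real N)"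
proof -
  have "\<exists>M. \<forall>m\<ge>M. \<forall>n\<ge>M. \<bar>real (cnt B m) / real m - real (cnt B n) / real n\<bar> < e"
    if e: "0 < e" for e :: real
  proof -
    \<comment> \<open>Two ratios, each within 2\<delta> of \<open>q\<close>, differ by at most
      4\<delta>, which is below \<open>e\<close>.\<close>
    define \<delta> where "\<delta> = e / 5"
    have \<delta>: "0 < \<delta>" using e \<delta>_def by simp
    obtain L D E where per: "periodic_set L D"
      and ex: "\<forall>n\<ge>1. n \<notin> E \<longrightarrow> (n \<in> B \<longleftrightarrow> n \<in> D)"
      and small: "eventually (\<lambda>N. real (cnt E N) \<le> \<delta> * real N) sequentially"
      using approx[OF \<delta>] by blast
    define q where "q = real (card (D \<inter> {..<L})) / real L"
    have "eventually (\<lambda>N. \<bar>real (cnt B N) / real N - q\<bar> \<le> 2 * \<delta>) sequentially"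
      using small eventually_const_le_linear[OF \<delta>, of "real L"] eventually_gt_at_top[of 0]
    proof eventually_elim
      case (elim N)
      have "cnt B N \<le> cnt (D \<union> E) N" by (rule cnt_mono) (use ex in auto)
      hence 1: "cnt B N \<le> cnt D N + cnt E N" using cnt_Un[of D E N] by linarith
      have "cnt D N \<le> cnt (B \<union> E) N" by (rule cnt_mono) (use ex in auto)
      hence 2: "cnt D N \<le> cnt B N + cnt E N" using cnt_Un[of B E N] by linarith
      have "\<bar>real (cnt D N) - real N * q\<bar> \<le> real L"
        using cnt_periodic[OF per, of N] by (simp add: q_def)
      hence "\<bar>real (cnt B N) - real N * q\<bar> \<le> 2 * \<delta> * real N"
        using 1 2 elim by linarith
      thus ?case using elim(3) by (simp add: field_simps abs_le_iff)
    qed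
    then obtain M where M: "\<And>N. N \<ge> M \<Longrightarrow> \<bar>real (cnt B N) / real N - q\<bar> \<le> 2 * \<delta>"
      by (auto simp: eventually_sequentially)
    show ?thesis
    proof (intro exI[of _ M] allI impI)
      fix m n assume "m \<ge> M" "n \<ge> M"
      thus "\<bar>real (cnt B m) / real m - real (cnt B n) / real n\<bar> < e"
        using M[of m] M[of n] \<delta>_def e by linarith
    qed
  qed
  hence "Cauchy (\<lambda>N. real (cnt B N) / real N)"
    by (intro CauchyI) simp
  thus ?thesis by (simp add: Cauchy_convergent_iff)
qed

lemma has_natural_density_cnt:
  assumes "(\<lambda>N. real (cnt A N) / real N) \<longlonglongrightarrow> \<delta>"
  shows "has_natural_density A \<delta>"
proof -
  have lim: "filterlim (\<lambda>x::real. nat \<lfloor>x\<rfloor>) at_top at_top" by real_asymp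
  have 1: "((\<lambda>x::real. real (cnt A (nat \<lfloor>x\<rfloor>)) / real (nat \<lfloor>x\<rfloor>)) \<longlongrightarrow> \<delta>) at_top"
    using filterlim_compose[OF assms lim] .
  have 2: "((\<lambda>x::real. real (nat \<lfloor>x\<rfloor>) / x) \<longlongrightarrow> 1) at_top" by real_asymp
  have "((\<lambda>x::real. real (cnt A (nat \<lfloor>x\<rfloor>)) / real (nat \<lfloor>x\<rfloor>) * (real (nat \<lfloor>x\<rfloor>) / x)) \<longlongrightarrow> \<delta>) at_top"
    using tendsto_mult[OF 1 2] by simp
  moreover have "eventually (\<lambda>x::real. real (cnt A (nat \<lfloor>x\<rfloor>)) / real (nat \<lfloor>x\<rfloor>) * (real (nat \<lfloor>x\<rfloor>) / x)
     = real (card {n \<in> A. 1 \<le> n \<and> real n \<le> x}) / x) at_top"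
    using eventually_ge_at_top[of 1]
  proof eventually_elim
    case (elim x)
    have "{n \<in> A. 1 \<le> n \<and> real n \<le> x} = A \<inter> {1..nat \<lfloor>x\<rfloor>}"
      using elim by (auto simp: le_nat_iff le_floor_iff)
    moreover have "nat \<lfloor>x\<rfloor> \<noteq> 0" using elim by (simp add: le_floor_iff)
    ultimately show ?case by (simp add: cnt_def)
  qed
  ultimately show ?thesis
    unfolding has_natural_density_def by (rule Lim_transform_eventually)
qed

subsection \<open>The abundancy index\<close>

definition abundancy :: "nat \<Rightarrow> real" where
  "abundancy m = (\<Sum>d | d dvd m. 1 / real d)"

text \<open>For large \<open>y\<close> this measures the truncation error; for \<open>y = 1\<close>
  it is h(m) - 1, to which Markov's inequality is applied.\<close>

definition abundancy_tail :: "nat \<Rightarrow> nat \<Rightarrow> real" where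
  "abundancy_tail y m = (\<Sum>d | d dvd m \<and> y < d. 1 / real d)"

text \<open>The involution sending d to m/d on the divisors of m turns the sum of d into m times the
  sum of 1/d.\<close>

lemma divisor_sum_abundancy:
  assumes "0 < m"
  shows "real (divisor_sum m) = real m * abundancy m"
proof -
  have "(\<Sum>d | d dvd m. real d) = (\<Sum>d | d dvd m. real m * (1 / real d))"
  proof (rule sum.reindex_bij_witness[of _ "\<lambda>d. m div d" "\<lambda>d. m div d"])
    fix d assume "d \<in> {d. d dvd m}"
    then obtain k where "m = d * k" by (auto elim: dvdE)
    thus "m div (m div d) = d" "m div d \<in> {d. d dvd m}" "real m * (1 / real (m div d)) = real d"
      using assms by auto
  next
    fix d assume "d \<in> {d. d dvd m}"
    then obtain k where "m = d * k" by (auto elim: dvdE)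
    thus "m div (m div d) = d" "m div d \<in> {d. d dvd m}" using assms by auto
  qed
  thus ?thesis by (simp add: divisor_sum_def abundancy_def sum_distrib_left)
qed

lemma abundancy_ge_1: "0 < m \<Longrightarrow> 1 \<le> abundancy m"
  using member_le_sum[of 1 "{d. d dvd m}" "\<lambda>d. 1 / real d"] by (simp add: abundancy_def)

lemma abundancy_tail_nonneg: "0 \<le> abundancy_tail y m"
  unfolding abundancy_tail_def by (intro sum_nonneg) auto

lemma abundancy_eq_tail: "0 < m \<Longrightarrow> abundancy m = 1 + abundancy_tail 1 m"
proof -
  assume "0 < m"
  hence fin: "finite {d. d dvd m}" by simp
  have "d = 1 \<or> 1 < d" if "d dvd m" for d
    using dvd_pos_nat[OF \<open>0 < m\<close> that] by linarith
  hence ins: "{d. d dvd m} = insert 1 {d. d dvd m \<and> 1 < d}" by auto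
  have "abundancy m = (\<Sum>d\<in>insert 1 {d. d dvd m \<and> 1 < d}. 1 / real d)"
    unfolding abundancy_def using ins by simp
  also have "\<dots> = 1 + abundancy_tail 1 m"
    unfolding abundancy_tail_def by (subst sum.insert) (use fin in auto)
  finally show ?thesis .
qed

text \<open>The divisors of pm are those of m together with their multiples by p, and these two sets
  are disjoint.\<close>

lemma abundancy_prime_mult:
  assumes "prime p" "\<not> p dvd m" "0 < m"
  shows "abundancy (p * m) = (real p + 1) / real p * abundancy m"
proof -
  have p: "0 < p" using assms(1) by (simp add: prime_gt_0_nat)
  have eq: "{d. d dvd p * m} = {d. d dvd m} \<union> (*) p ` {d. d dvd m}"
  proof (intro Set.set_eqI iffI)
    fix d assume "d \<in> {d. d dvd p * m}"
    hence d: "d dvd p * m" by simp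
    show "d \<in> {d. d dvd m} \<union> (*) p ` {d. d dvd m}"
    proof (cases "p dvd d")
      case True
      then obtain e where "d = p * e" by (auto elim: dvdE)
      thus ?thesis using d p by auto
    next
      case False
      hence "coprime d p" using assms(1) by (metis coprime_commute prime_imp_coprime)
      thus ?thesis using d by (simp add: coprime_dvd_mult_right_iff)
    qed
  qed auto
  have "abundancy (p * m) = abundancy m + (\<Sum>d\<in>(*) p ` {d. d dvd m}. 1 / real d)"
    unfolding abundancy_def eq
    by (rule sum.union_disjoint) (use assms in \<open>auto dest: dvd_mult_left\<close>)
  also have "(\<Sum>d\<in>(*) p ` {d. d dvd m}. 1 / real d) = abundancy m / real p"
    unfolding abundancy_def
    by (subst sum.reindex) (use p in \<open>auto simp: inj_on_def sum_divide_distrib mult.commute\<close>)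
  finally show ?thesis using p by (simp add: field_simps)
qed

text \<open>The map sending d to dm embeds the divisors of k into those of km. This yields h(30n)
  \<ge> h(30), and h(30n) \<ge> h(60) for even n.\<close>

lemma divisor_sum_mult_ge:
  assumes "0 < k" "0 < m"
  shows "divisor_sum k * m \<le> divisor_sum (k * m)"
proof -
  have "divisor_sum k * m = (\<Sum>d\<in>(\<lambda>d. d * m) ` {d. d dvd k}. d)"
    unfolding divisor_sum_def
    by (subst sum.reindex) (use assms in \<open>auto simp: inj_on_def sum_distrib_right\<close>)
  also have "\<dots> \<le> divisor_sum (k * m)"
    unfolding divisor_sum_def by (rule sum_mono2) (use assms in auto)
  finally show ?thesis .
qed

section \<open>Mean values of divisor tails along 30n and 30n + 1\<close>

lemma sum_inverse_square_tail:
  assumes "0 < y"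
  shows "(\<Sum>d\<in>{y+1..K}. 1 / (real d)\<^sup>2) \<le> 1 / real y"
proof -
  \<comment> \<open>Strengthened by -1/K so that the induction telescopes.\<close>
  have "(\<Sum>d\<in>{y+1..K}. 1 / (real d)\<^sup>2) \<le> 1 / real y - 1 / real K" if "y \<le> K"
    using that
  proof (induction K rule: dec_induct)
    case base
    then show ?case by simp
  next
    case (step K)
    have K: "0 < real K" using step assms by simp
    have "1 / (real (Suc K))\<^sup>2 \<le> 1 / (real K * real (Suc K))"
      using K by (intro divide_left_mono) (auto simp: power2_eq_square)
    also have "\<dots> = 1 / real K - 1 / real (Suc K)"
      using K by (simp add: field_simps)
    finally have "1 / (real (Suc K))\<^sup>2 \<le> 1 / real K - 1 / real (Suc K)" .
    thus ?case using step by (simp add: sum.atLeast_Suc_atMost sum.cl_ivl_Suc)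
  qed
  thus ?thesis
  proof (cases "y \<le> K")
    case True
    have "0 \<le> 1 / real K" by simp
    with \<open>y \<le> K \<Longrightarrow> _\<close>[OF True] show ?thesis by linarith
  qed simp
qed

text \<open>The quotient (30n + b)/d determines n and is a positive integer at most 31N/d. Starting
  at 1, the quotients leave no additive error, so the bound can be summed over d up to 31N. It is
  crude by a constant factor but holds for every d.\<close>

lemma card_dvd_linear_le:
  assumes "0 < d" "b \<le> 1"
  shows "real (card {n\<in>{1..N}. d dvd 30 * n + b}) \<le> 31 * real N / real d"
proof -
  have "card {n\<in>{1..N}. d dvd 30 * n + b} \<le> card {1..(31 * N) div d}"
  proof (rule card_inj_on_le[of "\<lambda>n. (30 * n + b) div d"])
    show "inj_on (\<lambda>n. (30 * n + b) div d) {n\<in>{1..N}. d dvd 30 * n + b}"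
    proof (rule inj_onI)
      fix m n assume mn: "m \<in> {n\<in>{1..N}. d dvd 30 * n + b}" "n \<in> {n\<in>{1..N}. d dvd 30 * n + b}"
        "(30 * m + b) div d = (30 * n + b) div d"
      hence "30 * m + b = 30 * n + b" by (metis (mono_tags, lifting) dvd_div_eq_cancel mem_Collect_eq)
      thus "m = n" by simp
    qed
    have "Suc 0 \<le> (30 * n + b) div d \<and> (30 * n + b) div d \<le> 31 * N div d"
      if "n \<in> {1..N}" "d dvd 30 * n + b" for n
    proof
      have "d \<le> 30 * n + b" using that by (intro dvd_imp_le) auto
      thus "Suc 0 \<le> (30 * n + b) div d" using assms by (simp add: Suc_le_eq div_greater_zero_iff)
      show "(30 * n + b) div d \<le> 31 * N div d" using that assms by (intro div_le_mono) auto
    qed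
    thus "(\<lambda>n. (30 * n + b) div d) ` {n\<in>{1..N}. d dvd 30 * n + b} \<subseteq> {1..(31 * N) div d}" by auto
  qed simp
  hence "real (card {n\<in>{1..N}. d dvd 30 * n + b}) \<le> real ((31 * N) div d)" by simp
  also have "\<dots> \<le> real (31 * N) / real d" by (rule of_nat_div_le_of_nat)
  finally show ?thesis by simp
qed

text \<open>Interchange of summation; the range of d is complete because 30n + b \<le> 31N.\<close>

lemma sum_abundancy_tail:
  assumes "A \<subseteq> {1..N}" "b \<le> 1"
  shows "(\<Sum>n\<in>A. abundancy_tail y (30 * n + b)) =
    (\<Sum>d\<in>{y+1..31*N}. 1 / real d * real (card {n\<in>A. d dvd 30 * n + b}))"
proof -
  have fin: "finite A" using assms(1) finite_subset by blast
  have "abundancy_tail y (30 * n + b) = (\<Sum>d\<in>{y+1..31*N}. if d dvd 30 * n + b then 1 / real d else 0)"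
    if "n \<in> A" for n
  proof -
    have n: "1 \<le> n" "n \<le> N" using that assms by auto
    have "{d. d dvd 30 * n + b \<and> y < d} = {d\<in>{y+1..31*N}. d dvd 30 * n + b}"
    proof -
      have "d \<le> 31 * N" if "d dvd 30 * n + b" for d
        using dvd_imp_le[OF that] n assms by simp
      thus ?thesis by auto
    qed
    thus ?thesis unfolding abundancy_tail_def by (simp add: sum.inter_filter[symmetric])
  qed
  hence "(\<Sum>n\<in>A. abundancy_tail y (30 * n + b)) =
     (\<Sum>n\<in>A. \<Sum>d\<in>{y+1..31*N}. if d dvd 30 * n + b then 1 / real d else 0)" by simp
  also have "\<dots> = (\<Sum>d\<in>{y+1..31*N}. \<Sum>n\<in>A. if d dvd 30 * n + b then 1 / real d else 0)"
    by (rule sum.swap)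
  also have "\<dots> = (\<Sum>d\<in>{y+1..31*N}. 1 / real d * real (card {n\<in>A. d dvd 30 * n + b}))"
    using fin by (intro sum.cong) (auto simp: sum.inter_filter[symmetric])
  finally show ?thesis .
qed

lemma sum_abundancy_tail_le:
  assumes "b \<le> 1" "0 < y"
  shows "(\<Sum>n\<in>{1..N}. abundancy_tail y (30 * n + b)) \<le> 31 * real N / real y"
proof -
  have "(\<Sum>n\<in>{1..N}. abundancy_tail y (30 * n + b)) =
    (\<Sum>d\<in>{y+1..31*N}. 1 / real d * real (card {n\<in>{1..N}. d dvd 30 * n + b}))"
    by (rule sum_abundancy_tail) (use assms in auto)
  also have "\<dots> \<le> (\<Sum>d\<in>{y+1..31*N}. 1 / real d * (31 * real N / real d))"
    by (intro sum_mono mult_left_mono card_dvd_linear_le) (use assms in auto)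
  also have "\<dots> = 31 * real N * (\<Sum>d\<in>{y+1..31*N}. 1 / (real d)\<^sup>2)"
    by (simp add: sum_distrib_left power2_eq_square)
  also have "\<dots> \<le> 31 * real N * (1 / real y)"
    by (intro mult_left_mono sum_inverse_square_tail) (use assms in auto)
  finally show ?thesis by simp
qed

lemma cnt_abundancy_tail_gt:
  assumes "b \<le> 1" "0 < y" "0 < \<epsilon>"
  shows "real (cnt {n. \<epsilon> < abundancy_tail y (30 * n + b)} N) \<le> 31 / (real y * \<epsilon>) * real N"
proof -
  let ?A = "{n. \<epsilon> < abundancy_tail y (30 * n + b)} \<inter> {1..N}"
  have "\<epsilon> * real (card ?A) = (\<Sum>n\<in>?A. \<epsilon>)" by simp
  also have "\<dots> \<le> (\<Sum>n\<in>?A. abundancy_tail y (30 * n + b))" by (intro sum_mono) auto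
  also have "\<dots> \<le> (\<Sum>n\<in>{1..N}. abundancy_tail y (30 * n + b))"
    by (intro sum_mono2) (auto simp: abundancy_tail_nonneg)
  also have "\<dots> \<le> 31 * real N / real y" by (rule sum_abundancy_tail_le) (use assms in auto)
  finally show ?thesis unfolding cnt_def using assms by (simp add: field_simps)
qed

text \<open>Union bound over \<open>P\<close>. The bound does not involve \<open>w\<close>, so
  \<open>z\<close> can be fixed before the upper end of \<open>P\<close> is chosen.\<close>

lemma cnt_square_dvd:
  assumes "b \<le> 1" "0 < z" "P \<subseteq> {z<..w}"
  shows "real (cnt {n. \<exists>p\<in>P. p\<^sup>2 dvd 30 * n + b} N) \<le> 31 / real z * real N"
proof -
  have fin: "finite P" using assms(3) finite_subset by blast
  have un: "{n. \<exists>p\<in>P. p\<^sup>2 dvd 30 * n + b} \<inter> {1..N} = (\<Union>p\<in>P. {n\<in>{1..N}. p\<^sup>2 dvd 30 * n + b})" by auto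
  have "real (cnt {n. \<exists>p\<in>P. p\<^sup>2 dvd 30 * n + b} N) \<le> real (\<Sum>p\<in>P. card {n\<in>{1..N}. p\<^sup>2 dvd 30 * n + b})"
    unfolding cnt_def un by (simp only: of_nat_le_iff card_UN_le[OF fin])
  also have "\<dots> = (\<Sum>p\<in>P. real (card {n\<in>{1..N}. p\<^sup>2 dvd 30 * n + b}))" by simp
  also have "\<dots> \<le> (\<Sum>p\<in>P. 31 * real N / real (p\<^sup>2))"
  proof (intro sum_mono card_dvd_linear_le)
    fix p assume "p \<in> P"
    thus "0 < p\<^sup>2" using assms by auto
  qed (use assms in auto)
  also have "\<dots> = 31 * real N * (\<Sum>p\<in>P. 1 / (real p)\<^sup>2)"
    by (simp add: sum_distrib_left)
  also have "\<dots> \<le> 31 * real N * (\<Sum>p\<in>{z+1..w}. 1 / (real p)\<^sup>2)"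
    by (intro mult_left_mono sum_mono2) (use assms in auto)
  also have "\<dots> \<le> 31 * real N * (1 / real z)"
    by (intro mult_left_mono sum_inverse_square_tail) (use assms in auto)
  finally show ?thesis by simp
qed


subsection \<open>Residue classes\<close>

text \<open>The injectivity half of the Chinese remainder theorem.\<close>

lemma card_crt_le:
  fixes a b :: nat
  assumes "coprime a b" "0 < a" "0 < b" "finite W"
  shows "card {n. n < a * b \<and> (n mod a, n mod b) \<in> W} \<le> card W"
proof (rule card_inj_on_le[of "\<lambda>n. (n mod a, n mod b)"])
  show "inj_on (\<lambda>n. (n mod a, n mod b)) {n. n < a * b \<and> (n mod a, n mod b) \<in> W}"
  proof (rule inj_onI)
    fix m n assume h: "m \<in> {n. n < a * b \<and> (n mod a, n mod b) \<in> W}"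
      "n \<in> {n. n < a * b \<and> (n mod a, n mod b) \<in> W}"
      "(m mod a, m mod b) = (n mod a, n mod b)"
    hence "[m = n] (mod a)" "[m = n] (mod b)" by (auto simp: unique_euclidean_semiring_class.cong_def)
    hence "[m = n] (mod (a * b))" using assms(1) by (rule coprime_cong_mult_nat)
    thus "m = n" using h by (simp add: unique_euclidean_semiring_class.cong_def)
  qed
qed (use assms in auto)

text \<open>Residue 0 realises exactly the pattern p | 30n, p not dividing 30n + 1, and is its only
  member. Every other pattern misses 0, leaving at most p - 1 residues.\<close>

lemma card_prime_class_le:
  fixes p :: nat
  assumes "prime p" "coprime p 30"
  shows "card {n. n < p \<and> (p dvd 30 * n + 1 \<longleftrightarrow> a) \<and> (p dvd 30 * n \<longleftrightarrow> b)} \<le> p - 1"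
proof -
  have p: "1 < p" using assms(1) by (rule prime_gt_1_nat)
  let ?C = "{n. n < p \<and> (p dvd 30 * n + 1 \<longleftrightarrow> a) \<and> (p dvd 30 * n \<longleftrightarrow> b)}"
  show ?thesis
  proof (cases "b \<and> \<not> a")
    case True
    have "?C \<subseteq> {0}"
    proof
      fix n assume n: "n \<in> ?C"
      hence "p dvd 30 * n" using True by simp
      hence "p dvd n" using assms(2) by (simp add: coprime_dvd_mult_right_iff)
      thus "n \<in> {0}" using n by (auto dest: nat_dvd_not_less)
    qed
    hence "card ?C \<le> card {0::nat}" by (intro card_mono) auto
    thus ?thesis using p by simp
  next
    case False
    have "?C \<subseteq> {1..<p}"
    proof
      fix n assume n: "n \<in> ?C"
      have "n \<noteq> 0"
      proof
        assume "n = 0"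
        thus False using n False p by auto
      qed
      thus "n \<in> {1..<p}" using n by auto
    qed
    hence "card ?C \<le> card {1..<p}" by (intro card_mono) auto
    thus ?thesis by simp
  qed
qed

text \<open>Multiplies the bounds for the single primes through the Chinese remainder theorem;
  relative to \<open>\<Prod>P\<close> this is a density of at most the product of the 1 -
  1/p.\<close>

lemma card_joint_class_le:
  fixes P :: "nat set"
  assumes "finite P" "\<And>p. p \<in> P \<Longrightarrow> prime p \<and> coprime p 30"
  shows "card {n. n < \<Prod>P \<and> (\<forall>p\<in>P. (p dvd 30 * n + 1 \<longleftrightarrow> a p) \<and> (p dvd 30 * n \<longleftrightarrow> b p))}
     \<le> (\<Prod>p\<in>P. p - 1)"
  using assms
proof (induction P rule: finite_induct)
  case empty
  then show ?case by (simp add: card_le_Suc0_iff_eq)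
next
  case (insert p P)
  define C where "C q n \<longleftrightarrow> (q dvd 30 * n + 1 \<longleftrightarrow> a q) \<and> (q dvd 30 * n \<longleftrightarrow> b q)" for q n
  \<comment> \<open>The free factor k covers both reductions: modulo p with k = 1, and modulo
    \<open>\<Prod>P\<close> with k the product of the other primes.\<close>
  have C_mod: "C q (n mod (q * k)) \<longleftrightarrow> C q n" for q n k
  proof -
    have "q dvd 30 * (n mod (q * k)) + c \<longleftrightarrow> q dvd 30 * n + c" for c
    proof -
      have "[30 * (n mod (q * k)) + c = 30 * n + c] (mod q)"
        by (intro cong_add cong_mult) (auto simp: unique_euclidean_semiring_class.cong_def mod_mod_cancel)
      thus ?thesis by (rule cong_dvd_iff)
    qed
    from this[of 0] this[of 1] show ?thesis by (simp add: C_def)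
  qed
  have p: "prime p" "coprime p 30" using insert by auto
  have P: "\<And>q. q \<in> P \<Longrightarrow> prime q \<and> coprime q 30" using insert by auto
  have cop: "coprime p (\<Prod>P)"
    by (rule prod_coprime_right) (use P p insert.hyps primes_coprime in blast)
  have pos: "0 < p" "0 < \<Prod>P"
    using p P insert.hyps by (auto intro!: prod_pos simp: prime_gt_0_nat)
  let ?X = "{n. n < p \<and> C p n}" and ?Y = "{n. n < \<Prod>P \<and> (\<forall>q\<in>P. C q n)}"
  have "card {n. n < \<Prod>(insert p P) \<and> (\<forall>q\<in>insert p P. C q n)}
      \<le> card {n. n < p * \<Prod>P \<and> (n mod p, n mod \<Prod>P) \<in> ?X \<times> ?Y}"
  proof (intro card_mono)
    show "{n. n < \<Prod>(insert p P) \<and> (\<forall>q\<in>insert p P. C q n)}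
      \<subseteq> {n. n < p * \<Prod>P \<and> (n mod p, n mod \<Prod>P) \<in> ?X \<times> ?Y}"
    proof safe
      fix n assume n: "n < \<Prod>(insert p P)" "\<forall>q\<in>insert p P. C q n"
      show "n < p * \<Prod>P" using n insert.hyps by simp
      show "n mod p < p" "n mod \<Prod>P < \<Prod>P" using pos by auto
      show "C p (n mod p)" using C_mod[of p n 1] n by simp
      fix q assume q: "q \<in> P"
      have "\<Prod>P = q * \<Prod>(P - {q})" using q insert.hyps by (simp add: prod.remove)
      thus "C q (n mod \<Prod>P)" using C_mod[of q n "\<Prod>(P - {q})"] n q by simp
    qed
  qed auto
  also have "\<dots> \<le> card (?X \<times> ?Y)"
    by (rule card_crt_le) (use cop pos in auto)
  also have "\<dots> = card ?X * card ?Y" by simp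
  also have "\<dots> \<le> (p - 1) * (\<Prod>q\<in>P. q - 1)"
  proof (rule mult_mono)
    show "card ?X \<le> p - 1" using card_prime_class_le[OF p] by (simp add: C_def)
    show "card ?Y \<le> (\<Prod>q\<in>P. q - 1)" using insert.IH[OF P] by (simp add: C_def)
  qed auto
  also have "\<dots> = (\<Prod>q\<in>insert p P. q - 1)" using insert.hyps by simp
  finally show ?case by (simp add: C_def)
qed

subsection \<open>Products of the factors (p + 1) / p\<close>

(* The largest prime q of P divides neither q + 1 nor any p + 1 with p < q, so the exponent
   of q can be read off from the q-adic valuation of either side. *)
lemma prod_Suc_prime_power_inj:
  fixes P :: "nat set" and a b :: "nat \<Rightarrow> nat"
  assumes "finite P" "\<And>p. p \<in> P \<Longrightarrow> prime p \<and> odd p"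
    and "(\<Prod>p\<in>P. (p + 1) ^ a p * p ^ b p) = (\<Prod>p\<in>P. (p + 1) ^ b p * p ^ a p)"
  shows "\<forall>p\<in>P. a p = b p"
  using assms
proof (induction P rule: finite_linorder_max_induct)
  case empty
  then show ?case by simp
next
  case (insert q P)
  have q: "prime q" "odd q" using insert.prems by auto
  have P: "\<And>p. p \<in> P \<Longrightarrow> prime p \<and> odd p" using insert.prems by auto
  have notin: "q \<notin> P" using insert.hyps by auto
  have ndvd: "\<not> q dvd (p + 1) ^ x * p ^ y" if "p \<in> P" for p x y
  proof
    assume "q dvd (p + 1) ^ x * p ^ y"
    hence "q dvd p + 1 \<or> q dvd p" using q(1) by (auto simp: prime_dvd_mult_iff dest: prime_dvd_power)
    moreover have "p < q" "0 < p" using that insert.hyps P by (auto simp: prime_gt_0_nat)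
    \<comment> \<open>As p < q, the only remaining possibility is q = p + 1, which parity excludes
      for odd p and q.\<close>
    ultimately have "p + 1 = q" by (auto dest!: dvd_imp_le)
    thus False using q(2) P[OF that] by auto
  qed
  have mult: "multiplicity q ((q + 1) ^ x * q ^ y * (\<Prod>p\<in>P. (p + 1) ^ f p * p ^ g p)) = y" for x y f g
  proof -
    have "\<not> q dvd (q + 1) ^ x"
    proof
      assume "q dvd (q + 1) ^ x"
      hence "q dvd q + 1" using q(1) prime_dvd_power by blast
      hence "is_unit q" using dvd_add_right_iff[of q q 1] by simp
      thus False using q(1) by (simp add: prime_elem_not_unit)
    qed
    moreover have "\<not> q dvd (\<Prod>p\<in>P. (p + 1) ^ f p * p ^ g p)"
      using ndvd q(1) insert.hyps by (simp add: prime_dvd_prod_iff)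
    ultimately have "\<not> q dvd (q + 1) ^ x * (\<Prod>p\<in>P. (p + 1) ^ f p * p ^ g p)"
      using q(1) by (simp add: prime_dvd_mult_iff)
    moreover have "(q + 1) ^ x * q ^ y * (\<Prod>p\<in>P. (p + 1) ^ f p * p ^ g p)
      = q ^ y * ((q + 1) ^ x * (\<Prod>p\<in>P. (p + 1) ^ f p * p ^ g p))" by simp
    ultimately show ?thesis
      using q(1) by (intro multiplicity_decomposeI) auto
  qed
  have eq: "(q + 1) ^ a q * q ^ b q * (\<Prod>p\<in>P. (p + 1) ^ a p * p ^ b p)
      = (q + 1) ^ b q * q ^ a q * (\<Prod>p\<in>P. (p + 1) ^ b p * p ^ a p)"
    using insert.prems(2) insert.hyps notin by simp
  have ab: "a q = b q"
    using mult[of "a q" "b q" a b] mult[of "b q" "a q" b a] eq by simp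
  have "(\<Prod>p\<in>P. (p + 1) ^ a p * p ^ b p) = (\<Prod>p\<in>P. (p + 1) ^ b p * p ^ a p)"
    using eq ab q(1) by (auto simp: not_prime_0)
  hence "\<forall>p\<in>P. a p = b p" using insert.IH P by blast
  with ab show ?case by simp
qed

text \<open>Each p enters with its factor h(p) = 1 + 1/p whatever its exponent in m. This makes the
  value periodic modulo \<open>\<Prod>P\<close>, and correct as long as no square of a prime in
  \<open>P\<close> divides m.\<close>

definition prime_part :: "nat set \<Rightarrow> nat \<Rightarrow> real" where
  "prime_part P m = (\<Prod>p\<in>P. if p dvd m then (real p + 1) / real p else 1)"

lemma prime_part_pos:
  assumes "\<And>p. p \<in> P \<Longrightarrow> 0 < p"
  shows "0 < prime_part P m"
  unfolding prime_part_def
proof (rule prod_pos)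
  fix p assume "p \<in> P"
  thus "0 < (if p dvd m then (real p + 1) / real p else 1)"
    using assms by (auto intro!: divide_pos_pos)
qed


definition prime_ratio :: "nat set \<Rightarrow> nat \<Rightarrow> real" where
  "prime_ratio P n = prime_part P (30 * n + 1) / prime_part P (30 * n)"

text \<open>Cross-multiplication and clearing of denominators turn the equation into one between
  products of powers of p + 1 and p, which \<open>prod_Suc_prime_power_inj\<close> resolves.\<close>

lemma prime_ratio_inj:
  assumes "finite P" "\<And>p. p \<in> P \<Longrightarrow> prime p \<and> coprime p 30"
    and eq: "prime_ratio P m = prime_ratio P n"
  shows "\<forall>p\<in>P. (p dvd 30 * m + 1 \<longleftrightarrow> p dvd 30 * n + 1) \<and> (p dvd 30 * m \<longleftrightarrow> p dvd 30 * n)"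
proof -
  have pos: "0 < p" if "p \<in> P" for p using assms(2)[OF that] by (simp add: prime_gt_0_nat)
  \<comment> \<open>Exponents of 1 + 1/p on the two sides after cross-multiplication, which keeps
    them natural numbers.\<close>
  define a where "a p = (if p dvd 30 * m + 1 then 1 else 0) + (if p dvd 30 * n then 1 else 0::nat)" for p
  define b where "b p = (if p dvd 30 * n + 1 then 1 else 0) + (if p dvd 30 * m then 1 else 0::nat)" for p
  have "prime_part P (30 * m + 1) * prime_part P (30 * n) = prime_part P (30 * n + 1) * prime_part P (30 * m)"
    using eq prime_part_pos[of P "30 * m", OF pos] prime_part_pos[of P "30 * n", OF pos]
    unfolding prime_ratio_def by (simp add: frac_eq_eq)
  moreover have "prime_part P (30 * m + 1) * prime_part P (30 * n) = (\<Prod>p\<in>P. ((real p + 1) / real p) ^ a p)"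
    unfolding prime_part_def prod.distrib[symmetric] by (intro prod.cong) (auto simp: a_def power2_eq_square)
  moreover have "prime_part P (30 * n + 1) * prime_part P (30 * m) = (\<Prod>p\<in>P. ((real p + 1) / real p) ^ b p)"
    unfolding prime_part_def prod.distrib[symmetric] by (intro prod.cong) (auto simp: b_def power2_eq_square)
  ultimately have "(\<Prod>p\<in>P. ((real p + 1) / real p) ^ a p) = (\<Prod>p\<in>P. ((real p + 1) / real p) ^ b p)"
    by simp
  hence "(\<Prod>p\<in>P. ((real p + 1) / real p) ^ a p) * (\<Prod>p\<in>P. real p ^ a p * real p ^ b p)
       = (\<Prod>p\<in>P. ((real p + 1) / real p) ^ b p) * (\<Prod>p\<in>P. real p ^ a p * real p ^ b p)"
    by simp
  moreover have "(\<Prod>p\<in>P. ((real p + 1) / real p) ^ a p) * (\<Prod>p\<in>P. real p ^ a p * real p ^ b p)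
       = real (\<Prod>p\<in>P. (p + 1) ^ a p * p ^ b p)"
    unfolding prod.distrib[symmetric] of_nat_prod
    by (intro prod.cong) (use pos in \<open>auto simp: power_divide add.commute\<close>)
  moreover have "(\<Prod>p\<in>P. ((real p + 1) / real p) ^ b p) * (\<Prod>p\<in>P. real p ^ a p * real p ^ b p)
       = real (\<Prod>p\<in>P. (p + 1) ^ b p * p ^ a p)"
    unfolding prod.distrib[symmetric] of_nat_prod
    by (intro prod.cong) (use pos in \<open>auto simp: power_divide add.commute\<close>)
  ultimately have "(\<Prod>p\<in>P. (p + 1) ^ a p * p ^ b p) = (\<Prod>p\<in>P. (p + 1) ^ b p * p ^ a p)"
    by (simp only: of_nat_eq_iff)
  moreover have "prime p \<and> odd p" if "p \<in> P" for p
  proof -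
    have p: "prime p" "coprime p 30" using assms(2)[OF that] by auto
    have "\<not> even p"
    proof
      assume "even p"
      hence "2 dvd gcd p 30" by (intro gcd_greatest) auto
      thus False using p by simp
    qed
    thus ?thesis using p by simp
  qed
  ultimately have ab: "\<forall>p\<in>P. a p = b p"
    by (intro prod_Suc_prime_power_inj[OF assms(1)]) auto
  show ?thesis
  proof
    fix p assume "p \<in> P"
    hence p: "prime p" "a p = b p" using assms(2) ab by auto
    \<comment> \<open>Since the two divisibilities exclude each other, their difference as
      indicators already determines both.\<close>
    have "\<not> (p dvd 30 * k \<and> p dvd 30 * k + 1)" for k
      using p(1) dvd_add_right_iff[of p "30 * k" 1] by (auto simp: prime_elem_not_unit)
    from this[of m] this[of n] p(2)
    show "(p dvd 30 * m + 1 \<longleftrightarrow> p dvd 30 * n + 1) \<and> (p dvd 30 * m \<longleftrightarrow> p dvd 30 * n)"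
      unfolding a_def b_def by (auto split: if_splits)
  qed
qed

lemma dvd_linear_mod:
  assumes "(d::nat) dvd M"
  shows "d dvd 30 * (n mod M) + c \<longleftrightarrow> d dvd 30 * n + c"
proof -
  have "[30 * (n mod M) + c = 30 * n + c] (mod d)"
    using assms by (intro cong_add cong_mult)
      (auto simp: unique_euclidean_semiring_class.cong_def mod_mod_cancel)
  thus ?thesis by (rule cong_dvd_iff)
qed

lemma prime_ratio_mod:
  assumes "finite P"
  shows "prime_ratio P (n mod \<Prod>P) = prime_ratio P n"
proof -
  have "prime_part P (30 * (n mod \<Prod>P) + c) = prime_part P (30 * n + c)" for c
    unfolding prime_part_def
  proof (intro prod.cong refl)
    fix p assume "p \<in> P"
    hence "p dvd \<Prod>P" using dvd_prodI[OF assms, of p "\<lambda>p. p"] by simp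
    thus "(if p dvd 30 * (n mod \<Prod>P) + c then (real p + 1) / real p else 1) =
      (if p dvd 30 * n + c then (real p + 1) / real p else 1)" by (simp add: dvd_linear_mod)
  qed
  from this[of 0] this[of 1] show ?thesis by (simp add: prime_ratio_def)
qed

text \<open>As \<epsilon> tends to 0 from the right, (1 + \<epsilon>)^3 a tends to a, and only
  finitely many strict inequalities have to survive. The cube is the width of the window
  \<open>near_one\<close>.\<close>

lemma finite_set_gap:
  fixes V :: "real set"
  assumes "finite V" "\<And>v. v \<in> V \<Longrightarrow> 0 < v"
  shows "\<exists>\<epsilon>>0. \<forall>a\<in>V. \<forall>b\<in>V. a < b \<longrightarrow> (1 + \<epsilon>) ^ 3 * a < b"
proof -
  have "eventually (\<lambda>\<epsilon>::real. \<forall>a\<in>V. \<forall>b\<in>V. a < b \<longrightarrow> (1 + \<epsilon>) ^ 3 * a < b) (at_right 0)"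
  proof (intro eventually_ball_finite ballI assms(1))
    fix a b assume "a \<in> V" "b \<in> V"
    show "eventually (\<lambda>\<epsilon>::real. a < b \<longrightarrow> (1 + \<epsilon>) ^ 3 * a < b) (at_right 0)"
    proof (cases "a < b")
      case True
      have "((\<lambda>\<epsilon>::real. (1 + \<epsilon>) ^ 3 * a) \<longlongrightarrow> (1 + 0) ^ 3 * a) (at_right 0)"
        by (intro tendsto_intros)
      hence "eventually (\<lambda>\<epsilon>::real. (1 + \<epsilon>) ^ 3 * a < b) (at_right 0)"
        by (rule order_tendstoD) (use True in simp)
      thus ?thesis by eventually_elim simp
    qed simp
  qed
  moreover have "eventually (\<lambda>\<epsilon>::real. 0 < \<epsilon>) (at_right 0)" by (rule eventually_at_right_less)
  ultimately have "eventually (\<lambda>\<epsilon>::real. 0 < \<epsilon> \<and> (\<forall>a\<in>V. \<forall>b\<in>V. a < b \<longrightarrow> (1 + \<epsilon>) ^ 3 * a < b)) (at_right 0)"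
    by eventually_elim simp
  thus ?thesis using eventually_happens by fastforce
qed

(* The asymmetric window absorbs the truncation errors of both h(30n+1) and h(30n) and the factor
   (30n+1)/(30n); any two of its members have quotient at most (1 + \<epsilon>)^3. *)
definition near_one :: "real \<Rightarrow> real \<Rightarrow> bool" where
  "near_one \<epsilon> r \<longleftrightarrow> 1 \<le> r * (1 + \<epsilon>)\<^sup>2 \<and> r \<le> 1 + \<epsilon>"

text \<open>On a residue class modulo \<open>M\<close> the factor \<open>u\<close> is constant. By
  the gap condition the window then admits a single value of \<open>prime_ratio\<close>, hence a
  single divisibility pattern, which has at most \<open>(\<Prod>p\<in>P. p - 1)\<close> residues
  modulo \<open>\<Prod>P\<close>.\<close>

lemma card_near_one_le:
  fixes u :: "nat \<Rightarrow> real"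
  assumes P: "finite P" "\<And>p. p \<in> P \<Longrightarrow> prime p \<and> coprime p 30"
    and M: "0 < M" "coprime M (\<Prod>P)"
    and u: "\<And>n. 0 < u n" "\<And>n. u (n mod M) = u n"
    and \<epsilon>: "0 < \<epsilon>" "\<forall>a\<in>prime_ratio P ` {..<\<Prod>P}. \<forall>b\<in>prime_ratio P ` {..<\<Prod>P}.
              a < b \<longrightarrow> (1 + \<epsilon>) ^ 3 * a < b"
  shows "card {n. n < M * \<Prod>P \<and> near_one \<epsilon> (u n * prime_ratio P n)} \<le> M * (\<Prod>p\<in>P. p - 1)"
proof -
  have Q: "0 < \<Prod>P" using P by (auto intro!: prod_pos simp: prime_gt_0_nat)
  define F where "F c = {j. j < \<Prod>P \<and> near_one \<epsilon> (c * prime_ratio P j)}" for c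
  have fibre: "card (F c) \<le> (\<Prod>p\<in>P. p - 1)" if c: "0 < c" for c
  proof (cases "F c = {}")
    case False
    then obtain j0 where j0: "j0 \<in> F c" by blast
    have le: "\<not> prime_ratio P i < prime_ratio P j" if "i \<in> F c" "j \<in> F c" for i j
    proof
      assume lt: "prime_ratio P i < prime_ratio P j"
      have "c * prime_ratio P j \<le> 1 + \<epsilon>" using that by (simp add: F_def near_one_def)
      also have "\<dots> \<le> (1 + \<epsilon>) * (c * prime_ratio P i * (1 + \<epsilon>)\<^sup>2)"
        using that \<epsilon>(1) by (simp add: F_def near_one_def)
      also have "\<dots> = c * ((1 + \<epsilon>) ^ 3 * prime_ratio P i)"
        by (simp add: power2_eq_square power3_eq_cube)
      also have "\<dots> < c * prime_ratio P j"
      proof -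
        have "(1 + \<epsilon>) ^ 3 * prime_ratio P i < prime_ratio P j"
          using \<epsilon>(2) lt that by (auto simp: F_def)
        thus ?thesis using c by simp
      qed
      finally show False by simp
    qed
    have "F c \<subseteq> {n. n < \<Prod>P \<and> (\<forall>p\<in>P. (p dvd 30 * n + 1 \<longleftrightarrow> p dvd 30 * j0 + 1)
             \<and> (p dvd 30 * n \<longleftrightarrow> p dvd 30 * j0))}"
    proof
      fix j assume j: "j \<in> F c"
      hence "prime_ratio P j = prime_ratio P j0" using le[OF j j0] le[OF j0 j] by linarith
      from prime_ratio_inj[OF P this] j
      show "j \<in> {n. n < \<Prod>P \<and> (\<forall>p\<in>P. (p dvd 30 * n + 1 \<longleftrightarrow> p dvd 30 * j0 + 1)
             \<and> (p dvd 30 * n \<longleftrightarrow> p dvd 30 * j0))}" by (simp add: F_def)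
    qed
    hence "card (F c) \<le> card {n. n < \<Prod>P \<and> (\<forall>p\<in>P. (p dvd 30 * n + 1 \<longleftrightarrow> p dvd 30 * j0 + 1)
             \<and> (p dvd 30 * n \<longleftrightarrow> p dvd 30 * j0))}" by (intro card_mono) auto
    also have "\<dots> \<le> (\<Prod>p\<in>P. p - 1)" by (rule card_joint_class_le[OF P])
    finally show ?thesis .
  qed simp
  let ?W = "SIGMA i:{..<M}. F (u i)"
  have "{n. n < M * \<Prod>P \<and> near_one \<epsilon> (u n * prime_ratio P n)}
     \<subseteq> {n. n < M * \<Prod>P \<and> (n mod M, n mod \<Prod>P) \<in> ?W}"
    using M Q by (auto simp: F_def u prime_ratio_mod[OF P(1)])
  hence "card {n. n < M * \<Prod>P \<and> near_one \<epsilon> (u n * prime_ratio P n)}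
     \<le> card {n. n < M * \<Prod>P \<and> (n mod M, n mod \<Prod>P) \<in> ?W}" by (intro card_mono) auto
  also have "\<dots> \<le> card ?W"
    by (rule card_crt_le) (use M Q in \<open>auto simp: F_def\<close>)
  also have "\<dots> = (\<Sum>i<M. card (F (u i)))" by (rule card_SigmaI) (auto simp: F_def)
  also have "\<dots> \<le> (\<Sum>i<M. (\<Prod>p\<in>P. p - 1))" by (intro sum_mono fibre u)
  finally show ?thesis by simp
qed

subsection \<open>Divergence of the product over primes\<close>

text \<open>Finite form of the Euler product: splitting off the exact power of one prime bounds the
  sum by a geometric series times the sum for the remaining primes.\<close>

lemma sum_inverse_smooth_le:
  assumes "finite P" "\<And>p. p \<in> P \<Longrightarrow> prime p"
    and "finite A" "\<And>n. n \<in> A \<Longrightarrow> 0 < n \<and> prime_factors n \<subseteq> P"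
  shows "(\<Sum>n\<in>A. 1 / real n) \<le> (\<Prod>p\<in>P. real p / (real p - 1))"
  using assms
proof (induction P arbitrary: A rule: finite_induct)
  case empty
  have "A \<subseteq> {1}"
  proof
    fix n assume n: "n \<in> A"
    hence "0 < n" "prime_factors n = {}" using empty by auto
    thus "n \<in> {1}" by (simp add: prime_factorization_empty_iff)
  qed
  hence "(\<Sum>n\<in>A. 1 / real n) \<le> (\<Sum>n\<in>{1}. 1 / real n)" by (intro sum_mono2) auto
  thus ?case by simp
next
  case (insert p P)
  have p: "prime p" using insert.prems by auto
  have p1: "1 < real p" using prime_gt_1_nat[OF p] by simp
  \<comment> \<open>Exceeds every exponent of p occurring in \<open>A\<close>; inserting 0 keeps
    \<open>Max\<close> meaningful for empty \<open>A\<close>.\<close>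
  define K where "K = Suc (Max (insert 0 (multiplicity p ` A)))"
  define g where "g n = (multiplicity p n, n div p ^ multiplicity p n)" for n
  define A' where "A' = (\<lambda>n. n div p ^ multiplicity p n) ` A"
  have dec: "n = p ^ multiplicity p n * (n div p ^ multiplicity p n)" for n
    by (simp add: multiplicity_dvd)
  have A': "0 < m \<and> prime_factors m \<subseteq> P" if m: "m \<in> A'" for m
  proof -
    obtain n where n: "n \<in> A" "m = n div p ^ multiplicity p n" using m A'_def by auto
    have n0: "0 < n" "prime_factors n \<subseteq> insert p P" using insert.prems n by auto
    have m0: "0 < m" using dec[of n] n n0 by (metis mult_is_0 neq0_conv)
    have mn: "m dvd n" using dec[of n] n by (metis dvd_triv_right)
    have "\<not> p dvd m" using n n0 p by (metis multiplicity_decompose not_prime_unit gr0_conv_Suc nat.distinct(1))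
    moreover have "prime_factors m \<subseteq> prime_factors n" using mn n0 by (intro dvd_prime_factors) auto
    ultimately have "prime_factors m \<subseteq> P" using n0 by (auto simp: in_prime_factors_iff)
    thus ?thesis using m0 by simp
  qed
  have fin': "finite A'" using insert.prems by (simp add: A'_def)
  have IH: "(\<Sum>n\<in>A'. 1 / real n) \<le> (\<Prod>p\<in>P. real p / (real p - 1))"
    by (rule insert.IH) (use insert.prems fin' A' in auto)
  have inj: "inj_on g A"
  proof (rule inj_onI)
    fix m n assume "g m = g n"
    thus "m = n" using dec[of m] dec[of n] unfolding g_def by (metis prod.inject)
  qed
  have "(\<Sum>n\<in>A. 1 / real n) = (\<Sum>n\<in>A. (\<lambda>(k, m). 1 / real p ^ k * (1 / real m)) (g n))"
  proof (intro sum.cong refl)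
    fix n
    have "real n = real p ^ multiplicity p n * real (n div p ^ multiplicity p n)"
      using dec[of n] by (metis of_nat_mult of_nat_power)
    thus "1 / real n = (\<lambda>(k, m). 1 / real p ^ k * (1 / real m)) (g n)" by (simp add: g_def)
  qed
  also have "\<dots> = (\<Sum>x\<in>g ` A. (\<lambda>(k, m). 1 / real p ^ k * (1 / real m)) x)"
    by (simp add: sum.reindex[OF inj])
  also have "\<dots> \<le> (\<Sum>x\<in>{..<K} \<times> A'. (\<lambda>(k, m). 1 / real p ^ k * (1 / real m)) x)"
  proof (rule sum_mono2)
    have "multiplicity p n < K" if "n \<in> A" for n
      using that insert.prems(2) unfolding K_def by (auto simp: less_Suc_eq_le)
    thus "g ` A \<subseteq> {..<K} \<times> A'" unfolding g_def A'_def by auto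
  qed (use fin' in auto)
  also have "\<dots> = (\<Sum>k<K. (1 / real p) ^ k) * (\<Sum>m\<in>A'. 1 / real m)"
    by (simp add: sum.cartesian_product[symmetric] sum_product power_divide)
  also have "\<dots> \<le> real p / (real p - 1) * (\<Prod>p\<in>P. real p / (real p - 1))"
  proof (rule mult_mono[OF _ IH])
    have "(\<Sum>k<K. (1 / real p) ^ k) \<le> 1 / (1 - 1 / real p)"
      using p1 sum_le_suminf[of "\<lambda>k. (1 / real p) ^ k" "{..<K}"]
      by (simp add: suminf_geometric summable_geometric)
    also have "\<dots> = real p / (real p - 1)" using p1 by (simp add: field_simps)
    finally show "(\<Sum>k<K. (1 / real p) ^ k) \<le> real p / (real p - 1)" .
  qed (use p1 in \<open>auto intro!: sum_nonneg divide_nonneg_nonneg\<close>)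
  finally show ?case using insert.hyps by simp
qed

text \<open>The harmonic numbers diverge and are dominated by the product of p/(p - 1) over p \<le>
  w. The primes up to z contribute only the fixed factor \<open>c\<close>, so the product over z < p
  \<le> w is unbounded and its inverse tends to 0.\<close>

lemma prod_primes_small:
  fixes \<delta> :: real
  assumes "0 < \<delta>"
  shows "\<exists>w. (\<Prod>p\<in>{p. prime p \<and> z < p \<and> p \<le> w}. (real p - 1) / real p) \<le> \<delta>"
proof -
  define c where "c = (\<Prod>p\<in>{p::nat. prime p \<and> p \<le> z}. real p / (real p - 1))"
  have c: "0 < c" unfolding c_def
    by (intro prod_pos) (auto dest: prime_gt_1_nat)
  have "eventually (\<lambda>n. c / \<delta> \<le> (harm n :: real)) sequentially"
    using harm_at_top by (simp add: filterlim_at_top)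
  then obtain w where w: "c / \<delta> \<le> (harm w :: real)" "z \<le> w"
    by (metis eventually_sequentially nle_le order_refl)
  let ?P = "{p. prime p \<and> z < p \<and> p \<le> w}"
  have fin: "finite ?P" "finite {p::nat. prime p \<and> p \<le> z}" by (auto intro: finite_subset[of _ "{..max z w}"])
  have "harm w = (\<Sum>n\<in>{1..w}. 1 / real n)" by (simp add: harm_def divide_inverse)
  also have "\<dots> \<le> (\<Prod>p\<in>{p. prime p \<and> p \<le> w}. real p / (real p - 1))"
  proof (rule sum_inverse_smooth_le)
    fix n assume "n \<in> {1..w}"
    thus "0 < n \<and> prime_factors n \<subseteq> {p. prime p \<and> p \<le> w}"
      by (auto simp: in_prime_factors_iff dest!: dvd_imp_le)
  qed auto
  also have "{p. prime p \<and> p \<le> w} = {p. prime p \<and> p \<le> z} \<union> ?P" using w by auto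
  also have "(\<Prod>p\<in>{p. prime p \<and> p \<le> z} \<union> ?P. real p / (real p - 1))
      = c * (\<Prod>p\<in>?P. real p / (real p - 1))"
    unfolding c_def by (rule prod.union_disjoint) (use fin in auto)
  finally have "c / \<delta> \<le> c * (\<Prod>p\<in>?P. real p / (real p - 1))" using w by linarith
  hence "c * (1 / \<delta>) \<le> c * (\<Prod>p\<in>?P. real p / (real p - 1))" by simp
  hence "1 / \<delta> \<le> (\<Prod>p\<in>?P. real p / (real p - 1))" using c by (simp only: mult_le_cancel_left_pos)
  moreover have "(\<Prod>p\<in>?P. (real p - 1) / real p) = inverse (\<Prod>p\<in>?P. real p / (real p - 1))"
    by (simp add: prod_inversef[symmetric])
  ultimately have "(\<Prod>p\<in>?P. (real p - 1) / real p) \<le> \<delta>"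
    using assms le_imp_inverse_le[of "1 / \<delta>"] by simp
  thus ?thesis by (intro exI[of _ w]) simp
qed


subsection \<open>Truncating the abundancy index\<close>

text \<open>Strips the primes of \<open>P\<close> from m one at a time. Each divides m at most once,
  so \<open>abundancy_prime_mult\<close> applies at every removal.\<close>

lemma abundancy_decomp:
  assumes "finite P" "\<And>p. p \<in> P \<Longrightarrow> prime p" "0 < m" "\<And>p. p \<in> P \<Longrightarrow> \<not> p\<^sup>2 dvd m"
  shows "\<exists>k. m = k * \<Prod>{p\<in>P. p dvd m} \<and> (\<forall>p\<in>P. \<not> p dvd k) \<and> abundancy m = abundancy k * prime_part P m"
  using assms
proof (induction P rule: finite_induct)
  case empty
  then show ?case by (simp add: prime_part_def)
next
  case (insert p P)
  let ?S = "{q\<in>P. q dvd m}"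
  obtain k where k: "m = k * \<Prod>?S" "\<forall>q\<in>P. \<not> q dvd k" "abundancy m = abundancy k * prime_part P m"
    using insert.IH insert.prems by auto
  have p: "prime p" using insert.prems by auto
  show ?case
  proof (cases "p dvd m")
    case False
    hence "{q \<in> insert p P. q dvd m} = ?S" by auto
    moreover have "\<not> p dvd k" using False k(1) by (metis dvd_mult2)
    moreover have "prime_part (insert p P) m = prime_part P m"
      using insert.hyps False by (simp add: prime_part_def)
    ultimately show ?thesis using k by (intro exI[of _ k]) auto
  next
    case True
    have "\<not> p dvd \<Prod>?S"
    proof
      assume "p dvd \<Prod>?S"
      then obtain q where "q \<in> P" "p dvd q" using p insert.hyps(1) by (auto simp: prime_dvd_prod_iff)
      hence "p = q" using p insert.prems(1) by (intro primes_dvd_imp_eq) auto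
      thus False using \<open>q \<in> P\<close> insert.hyps by simp
    qed
    moreover have "p dvd k * \<Prod>?S" using True k(1) by metis
    ultimately have "p dvd k" using p by (simp add: prime_dvd_mult_iff)
    then obtain l where l: "k = p * l" by (auto elim: dvdE)
    have m: "m = l * (p * \<Prod>?S)" using k(1) l by (simp only: ac_simps)
    have l0: "0 < l" using m insert.prems(2) by (metis mult_is_0 neq0_conv)
    have pl: "\<not> p dvd l"
    proof
      assume "p dvd l"
      hence "p * p dvd l * (p * \<Prod>?S)" by (intro mult_dvd_mono) auto
      hence "p\<^sup>2 dvd m" using m by (metis power2_eq_square)
      thus False using insert.prems by auto
    qed
    have "{q \<in> insert p P. q dvd m} = insert p ?S" using True by auto
    hence "\<Prod>{q \<in> insert p P. q dvd m} = p * \<Prod>?S" using insert.hyps by simp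
    hence 1: "m = l * \<Prod>{q \<in> insert p P. q dvd m}" using m by metis
    have 2: "\<forall>q\<in>insert p P. \<not> q dvd l" using pl k(2) l by auto
    have "prime_part (insert p P) m = (real p + 1) / real p * prime_part P m"
      using insert.hyps True by (simp add: prime_part_def)
    hence 3: "abundancy m = abundancy l * prime_part (insert p P) m"
      using k(3) abundancy_prime_mult[OF p pl l0] l by simp
    from 1 2 3 show ?thesis by blast
  qed
qed

text \<open>A modulus coprime to \<open>Q\<close> that every d \<le> y coprime to \<open>Q\<close>
  divides, so that the gcd with m retains all such divisors of m. It may retain larger ones
  too.\<close>

definition coprime_product :: "nat \<Rightarrow> nat \<Rightarrow> nat" where
  "coprime_product y Q = \<Prod>{d\<in>{1..y}. coprime d Q}"

lemma coprime_product_pos: "0 < coprime_product y Q"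
  unfolding coprime_product_def by (intro prod_pos) auto

lemma coprime_coprime_product: "coprime (coprime_product y Q) Q"
  unfolding coprime_product_def by (intro prod_coprime_left) auto

text \<open>With k the part of m free of primes in \<open>P\<close>, every divisor of the gcd
  divides k, and every divisor of k divides the gcd or exceeds y.\<close>

lemma abundancy_truncation:
  fixes P :: "nat set" and m y :: nat
  assumes P: "finite P" "\<And>p. p \<in> P \<Longrightarrow> prime p"
    and m: "0 < m" "\<And>p. p \<in> P \<Longrightarrow> \<not> p\<^sup>2 dvd m"
  defines "H \<equiv> abundancy (gcd m (coprime_product y (\<Prod>P))) * prime_part P m"
  shows "H \<le> abundancy m" "abundancy m \<le> H * (1 + abundancy_tail y m)"
proof -
  define g where "g = gcd m (coprime_product y (\<Prod>P))"
  obtain k where k: "m = k * \<Prod>{p\<in>P. p dvd m}" "\<forall>p\<in>P. \<not> p dvd k"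
      "abundancy m = abundancy k * prime_part P m"
    using abundancy_decomp[OF P m] by blast
  have k0: "0 < k" using k(1) m(1) by (metis mult_is_0 neq0_conv)
  have g0: "0 < g" using m(1) by (simp add: g_def)
  have pp: "0 < prime_part P m" using P(2) by (intro prime_part_pos) (auto simp: prime_gt_0_nat)
  have km: "k dvd m" using k(1) by (metis dvd_triv_left)
  have "{d. d dvd g} \<subseteq> {d. d dvd k}"
  proof safe
    fix d assume d: "d dvd g"
    hence "d dvd coprime_product y (\<Prod>P)" and dm: "d dvd m" by (auto simp: g_def)
    hence "coprime d (\<Prod>P)" using coprime_coprime_product coprime_divisors dvd_refl by blast
    moreover have "\<Prod>{p\<in>P. p dvd m} dvd \<Prod>P" using P(1) by (intro prod_dvd_prod_subset) auto
    ultimately have "coprime d (\<Prod>{p\<in>P. p dvd m})" using coprime_divisors dvd_refl by blast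
    moreover have "d dvd k * \<Prod>{p\<in>P. p dvd m}" using dm k(1) by metis
    ultimately show "d dvd k" by (simp add: coprime_dvd_mult_left_iff)
  qed
  hence lower: "abundancy g \<le> abundancy k"
    unfolding abundancy_def using k0 by (intro sum_mono2) auto
  have sub: "{d. d dvd k} \<subseteq> {d. d dvd g} \<union> {d. d dvd m \<and> y < d}"
  proof
    fix d assume "d \<in> {d. d dvd k}"
    hence d: "d dvd k" "d dvd m" "0 < d" using km k0 by (auto intro: dvd_trans dvd_pos_nat)
    show "d \<in> {d. d dvd g} \<union> {d. d dvd m \<and> y < d}"
    proof (cases "y < d")
      case False
      have "coprime d p" if "p \<in> P" for p
      proof -
        have "\<not> p dvd d" using k(2) d(1) that dvd_trans by blast
        thus ?thesis using P(2)[OF that] prime_imp_coprime coprime_commute by blast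
      qed
      hence "coprime d (\<Prod>P)" by (intro prod_coprime_right) auto
      hence "d \<in> {d\<in>{1..y}. coprime d (\<Prod>P)}" using False d by auto
      hence "d dvd coprime_product y (\<Prod>P)"
        unfolding coprime_product_def
        using dvd_prodI[of "{d\<in>{1..y}. coprime d (\<Prod>P)}" d "\<lambda>d. d"] by simp
      thus ?thesis using d by (simp add: g_def)
    qed (use d in simp)
  qed
  have "abundancy k \<le> (\<Sum>d\<in>{d. d dvd g} \<union> {d. d dvd m \<and> y < d}. 1 / real d)"
    unfolding abundancy_def using m(1) g0 sub by (intro sum_mono2) auto
  also have "\<dots> \<le> abundancy g + abundancy_tail y m"
    unfolding abundancy_def abundancy_tail_def using m(1) g0
    by (subst sum.union_inter[symmetric]) (auto intro!: sum_nonneg)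
  \<comment> \<open>The additive error becomes a factor because \<open>abundancy g\<close> is at
    least 1.\<close>
  also have "\<dots> \<le> abundancy g * (1 + abundancy_tail y m)"
    using mult_right_mono[OF abundancy_ge_1[OF g0] abundancy_tail_nonneg[of y m]] by (simp add: algebra_simps)
  finally have upper: "abundancy k \<le> abundancy g * (1 + abundancy_tail y m)" .
  show "H \<le> abundancy m"
    unfolding H_def k(3) g_def[symmetric] using lower pp by simp
  show "abundancy m \<le> H * (1 + abundancy_tail y m)"
    unfolding H_def k(3) g_def[symmetric] using mult_right_mono[OF upper, of "prime_part P m"] pp
    by (simp add: mult.commute mult.left_commute)
qed

section \<open>Periodic approximation of the set B\<close>

lemma gcd_linear_mod: "gcd (30 * (n mod M) + c) (M::nat) = gcd (30 * n + c) M"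
proof -
  have "[30 * (n mod M) + c = 30 * n + c] (mod M)"
    by (intro cong_add cong_mult) (auto simp: unique_euclidean_semiring_class.cong_def)
  thus ?thesis by (rule cong_gcd_eq)
qed

text \<open>If only the truncated inequality holds, then ha < hb, which bounds Ha/Hb above by 1 +
  \<epsilon>. If only the exact one holds, the truncation of ha and the factor (30n + 1)/(30n) each
  cost 1 + \<epsilon>, hence the square in the lower bound.\<close>

lemma near_one_if_truncation_disagrees:
  fixes Ha Hb ha hb \<epsilon> :: real
  assumes pos: "0 < Ha" "0 < Hb" "0 < \<epsilon>" and n: "0 < n" "1 \<le> \<epsilon> * real n"
    and a: "Ha \<le> ha" "ha \<le> Ha * (1 + \<epsilon>)" and b: "Hb \<le> hb" "hb \<le> Hb * (1 + \<epsilon>)"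
    and disagree: "(real (30 * n + 1) * ha \<ge> real (30 * n) * hb) \<noteq> (Ha / Hb \<ge> 1)"
  shows "near_one \<epsilon> (Ha / Hb)"
proof (cases "Ha / Hb \<ge> 1")
  case True
  hence "real (30 * n + 1) * ha < real (30 * n) * hb" using disagree by auto
  moreover have "real (30 * n) * ha \<le> real (30 * n + 1) * ha"
    using a pos by (intro mult_right_mono) auto
  ultimately have "real (30 * n) * ha < real (30 * n) * hb" by linarith
  hence "ha < hb" using n by simp
  hence "Ha \<le> Hb * (1 + \<epsilon>)" using a b by linarith
  moreover have "1 \<le> (1 + \<epsilon>)\<^sup>2" using pos by simp
  hence "1 * 1 \<le> Ha / Hb * (1 + \<epsilon>)\<^sup>2" using True by (intro mult_mono) auto
  ultimately show ?thesis unfolding near_one_def using pos by (simp add: field_simps)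
next
  case False
  hence "real (30 * n) * hb \<le> real (30 * n + 1) * ha" using disagree by auto
  moreover have "real (30 * n) * Hb \<le> real (30 * n) * hb" using b by (intro mult_left_mono) auto
  \<comment> \<open>Here 1 \<le> \<epsilon>n gives 30n + 1 \<le> 30n(1 + \<epsilon>).\<close>
  moreover have "real (30 * n + 1) * ha \<le> (real (30 * n) * (1 + \<epsilon>)) * (Ha * (1 + \<epsilon>))"
    using n a pos by (intro mult_mono) (auto simp: algebra_simps)
  moreover have "(real (30 * n) * (1 + \<epsilon>)) * (Ha * (1 + \<epsilon>)) = real (30 * n) * (Ha * (1 + \<epsilon>)\<^sup>2)"
    by (simp only: power2_eq_square ac_simps)
  ultimately have "real (30 * n) * Hb \<le> real (30 * n) * (Ha * (1 + \<epsilon>)\<^sup>2)"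
    by linarith
  hence "Hb \<le> Ha * (1 + \<epsilon>)\<^sup>2" using n by simp
  hence "1 \<le> Ha / Hb * (1 + \<epsilon>)\<^sup>2" using pos by (simp add: field_simps)
  moreover have "Ha / Hb \<le> 1 + \<epsilon>" using False pos by linarith
  ultimately show ?thesis by (simp add: near_one_def)
qed

lemma cnt_below_le: "real (cnt {n. \<epsilon> * real n < 1} N) \<le> 1 / \<epsilon>" if "0 < \<epsilon>"
proof -
  have "{n. \<epsilon> * real n < 1} \<inter> {1..N} \<subseteq> {1..nat \<lfloor>1 / \<epsilon>\<rfloor>}"
    using that by (auto simp: le_nat_floor field_simps)
  hence "cnt {n. \<epsilon> * real n < 1} N \<le> nat \<lfloor>1 / \<epsilon>\<rfloor>"
    unfolding cnt_def using card_mono[of "{1..nat \<lfloor>1 / \<epsilon>\<rfloor>}"] by fastforce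
  moreover have "real (nat \<lfloor>1 / \<epsilon>\<rfloor>) \<le> 1 / \<epsilon>" using that by simp
  ultimately show ?thesis by linarith
qed

lemma coprime_30_if_large_prime:
  assumes "prime (p::nat)" "30 < p"
  shows "coprime p 30"
proof -
  have "\<not> p dvd 30" using assms by (auto dest: dvd_imp_le)
  thus ?thesis using assms(1) by (rule prime_imp_coprime[rotated])
qed

text \<open>The parameters are chosen in the order z, w (hence \<open>P\<close>), \<epsilon>, y, M,
  each depending on the earlier ones: the gap \<epsilon> depends on \<open>P\<close>, and the tails
  must be small relative to \<epsilon>.\<close>

lemma convergent_cnt_divisor_sum:
  "convergent (\<lambda>N. real (cnt {n. 1 \<le> n \<and> divisor_sum (30 * n + 1) \<ge> divisor_sum (30 * n)} N) / real N)"
    (is "convergent (\<lambda>N. real (cnt ?B N) / real N)")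
proof (rule cnt_ratio_convergent)
  fix \<delta> :: real assume \<delta>: "0 < \<delta>"
  \<comment> \<open>248 = 4 * 2 * 31: the two square-divisor sets together get a quarter of
    \<delta>. The summand 30 makes all primes of \<open>P\<close> coprime to 30.\<close>
  obtain z :: nat where z: "248 / \<delta> + 30 < real z" using reals_Archimedean2 by blast
  have "0 < 248 / \<delta>" using \<delta> by simp
  hence "30 < real z" using z by linarith
  hence z30: "30 < z" by simp
  have "248 / \<delta> < real z" using z by linarith
  hence zd: "62 / real z \<le> \<delta> / 4" using \<delta> z30 by (simp add: field_simps)
  obtain w where w: "(\<Prod>p\<in>{p. prime p \<and> z < p \<and> p \<le> w}. (real p - 1) / real p) \<le> \<delta> / 4"
    using prod_primes_small[of "\<delta> / 4" z] \<delta> by auto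
  define P where "P = {p. prime p \<and> z < p \<and> p \<le> w}"
  have Pz: "P \<subseteq> {z<..w}" by (auto simp: P_def)
  have fin: "finite P" using Pz finite_subset by blast
  have P: "prime p \<and> coprime p 30" if "p \<in> P" for p
    using that z30 coprime_30_if_large_prime by (auto simp: P_def)
  have P0: "0 < p" if "p \<in> P" for p using P[OF that] by (simp add: prime_gt_0_nat)
  define Q where "Q = \<Prod>P"
  have Q: "0 < Q" unfolding Q_def using P0 by (intro prod_pos) auto
  obtain \<epsilon> where \<epsilon>: "0 < \<epsilon>" and gap: "\<forall>a\<in>prime_ratio P ` {..<Q}. \<forall>b\<in>prime_ratio P ` {..<Q}.
       a < b \<longrightarrow> (1 + \<epsilon>) ^ 3 * a < b"
  proof -
    have "0 < prime_ratio P j" for j unfolding prime_ratio_def using P0 by (intro divide_pos_pos prime_part_pos)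
    thus ?thesis using finite_set_gap[of "prime_ratio P ` {..<Q}"] that by auto
  qed
  obtain y :: nat where y: "248 / (\<delta> * \<epsilon>) < real y" using reals_Archimedean2 by blast
  have "0 < 248 / (\<delta> * \<epsilon>)" using \<delta> \<epsilon> by simp
  hence "0 < real y" using y by linarith
  hence y0: "0 < y" by simp
  have yd: "62 / (real y * \<epsilon>) \<le> \<delta> / 4" using y y0 \<delta> \<epsilon> by (simp add: field_simps)
  define M where "M = coprime_product y Q"
  have M: "0 < M" "coprime M Q" by (simp_all add: M_def coprime_product_pos coprime_coprime_product)
  define u where "u n = abundancy (gcd (30 * n + 1) M) / abundancy (gcd (30 * n) M)" for n
  have u_pos: "0 < u n" for n
  proof -
    have "0 < gcd (30 * n + 1) M" "0 < gcd (30 * n) M" using M by auto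
    thus ?thesis unfolding u_def by (metis abundancy_ge_1 divide_pos_pos less_le_trans zero_less_one)
  qed
  have u_mod: "u (n mod M) = u n" for n
    using gcd_linear_mod[of n M 0] gcd_linear_mod[of n M 1] by (simp add: u_def)
  define r where "r n = u n * prime_ratio P n" for n
  have r_mod: "r (n mod (M * Q)) = r n" for n
  proof -
    have "u (n mod (M * Q)) = u n" using u_mod[of "n mod (M * Q)"] u_mod[of n] by (simp add: mod_mod_cancel)
    moreover have "prime_ratio P (n mod (M * Q)) = prime_ratio P n"
      using prime_ratio_mod[OF fin, of "n mod (M * Q)"] prime_ratio_mod[OF fin, of n]
      by (simp add: mod_mod_cancel Q_def)
    ultimately show ?thesis by (simp add: r_def)
  qed
  have MQ: "0 < M * Q" using M Q by simp
  define D where "D = {n. 1 \<le> r n}"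
  define E1 where "E1 b = {n. \<exists>p\<in>P. p\<^sup>2 dvd 30 * n + b}" for b
  define E2 where "E2 b = {n. \<epsilon> < abundancy_tail y (30 * n + b)}" for b
  define E3 where "E3 = {n. \<epsilon> * real n < 1}"
  define E4 where "E4 = {n. near_one \<epsilon> (r n)}"
  \<comment> \<open>The n where the truncation is inaccurate, where n is too small to absorb (30n +
    1)/(30n), or where the truncated ratio is too close to 1 to decide.\<close>
  define E where "E = E1 0 \<union> (E1 1 \<union> (E2 0 \<union> (E2 1 \<union> (E3 \<union> E4))))"
  have D_per: "periodic_set (M * Q) D" and E4_per: "periodic_set (M * Q) E4"
    using MQ by (auto simp: periodic_set_def D_def E4_def r_mod)
  have BD: "n \<in> ?B \<longleftrightarrow> n \<in> D" if n: "1 \<le> n" "n \<notin> E" for n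
  proof (rule ccontr)
    assume disagree: "\<not> (n \<in> ?B \<longleftrightarrow> n \<in> D)"
    have notE: "n \<notin> E1 0" "n \<notin> E1 1" "n \<notin> E2 0" "n \<notin> E2 1" "n \<notin> E3" "n \<notin> E4"
      using n by (auto simp: E_def)
    define H where "H m = abundancy (gcd m M) * prime_part P m" for m
    have bounds: "H m \<le> abundancy m" "abundancy m \<le> H m * (1 + \<epsilon>)" "0 < H m"
      if m: "m = 30 * n + b" "b = 0 \<or> b = 1" for m b
    proof -
      have m0: "0 < m" using m n by auto
      have sq: "\<not> p\<^sup>2 dvd m" if "p \<in> P" for p using notE m that by (auto simp: E1_def)
      have T: "abundancy_tail y m \<le> \<epsilon>" using notE m by (auto simp: E2_def)
      have "0 < gcd m M" using M by simp
      hence "0 < abundancy (gcd m M)" using abundancy_ge_1 less_le_trans zero_less_one by blast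
      moreover have "0 < prime_part P m" using P0 by (intro prime_part_pos)
      ultimately show pos: "0 < H m" by (simp add: H_def)
      note tr = abundancy_truncation[OF fin _ m0, where y = y, folded Q_def, folded M_def, folded H_def]
      show "H m \<le> abundancy m" using tr(1) P sq by blast
      have "abundancy m \<le> H m * (1 + abundancy_tail y m)" using tr(2) P sq by blast
      also have "\<dots> \<le> H m * (1 + \<epsilon>)" using T pos by simp
      finally show "abundancy m \<le> H m * (1 + \<epsilon>)" .
    qed
    have r: "r n = H (30 * n + 1) / H (30 * n)" by (simp add: r_def u_def prime_ratio_def H_def)
    have "n \<in> ?B \<longleftrightarrow> real (divisor_sum (30 * n + 1)) \<ge> real (divisor_sum (30 * n))"
      using n by simp
    also have "\<dots> \<longleftrightarrow> real (30 * n + 1) * abundancy (30 * n + 1) \<ge> real (30 * n) * abundancy (30 * n)"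
      using n by (subst (1 2) divisor_sum_abundancy) auto
    finally have B_iff: "n \<in> ?B \<longleftrightarrow> real (30 * n + 1) * abundancy (30 * n + 1) \<ge> real (30 * n) * abundancy (30 * n)" .
    have "near_one \<epsilon> (H (30 * n + 1) / H (30 * n))"
    proof (rule near_one_if_truncation_disagrees)
      show "0 < n" "1 \<le> \<epsilon> * real n" using n notE by (auto simp: E3_def)
      show "(real (30 * n) * abundancy (30 * n) \<le> real (30 * n + 1) * abundancy (30 * n + 1))
          \<noteq> (1 \<le> H (30 * n + 1) / H (30 * n))"
        using disagree B_iff r unfolding D_def by simp
    qed (use bounds[of "30 * n" 0] bounds[of "30 * n + 1" 1] \<epsilon> in auto)
    thus False using notE r by (simp add: E4_def)
  qed
  have E1: "real (cnt (E1 b) N) \<le> 31 / real z * real N" if "b \<le> 1" for b N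
    unfolding E1_def by (rule cnt_square_dvd) (use that z30 Pz in auto)
  have E2: "real (cnt (E2 b) N) \<le> 31 / (real y * \<epsilon>) * real N" if "b \<le> 1" for b N
    unfolding E2_def by (rule cnt_abundancy_tail_gt) (use that y0 \<epsilon> in auto)
  have E3: "real (cnt E3 N) \<le> 1 / \<epsilon>" for N unfolding E3_def by (rule cnt_below_le[OF \<epsilon>])
  have E4: "real (cnt E4 N) \<le> \<delta> / 4 * real N + real (M * Q)" for N
  proof -
    have "E4 \<inter> {..<M * Q} = {n. n < M * \<Prod>P \<and> near_one \<epsilon> (u n * prime_ratio P n)}"
      by (auto simp: E4_def r_def Q_def)
    hence "card (E4 \<inter> {..<M * Q}) \<le> M * (\<Prod>p\<in>P. p - 1)"
      using card_near_one_le[where P = P and u = u, OF fin P M(1) M(2)[unfolded Q_def] u_pos u_mod \<epsilon> gap[unfolded Q_def]] by simp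
    hence "real (card (E4 \<inter> {..<M * Q})) \<le> real M * real (\<Prod>p\<in>P. p - 1)"
      by (metis of_nat_le_iff of_nat_mult)
    \<comment> \<open>Dividing by \<open>M * Q\<close> leaves the product of the 1 - 1/p, which the
      choice of w made at most \<delta>/4.\<close>
    also have "real (\<Prod>p\<in>P. p - 1) = real Q * (\<Prod>p\<in>P. (real p - 1) / real p)"
      unfolding Q_def of_nat_prod prod.distrib[symmetric]
      by (intro prod.cong refl) (use P0 in \<open>force simp: of_nat_diff Suc_le_eq\<close>)
    also have "real M * \<dots> \<le> real M * (real Q * (\<delta> / 4))"
      using w by (intro mult_left_mono) (auto simp: P_def)
    finally have "real (card (E4 \<inter> {..<M * Q})) / real (M * Q) \<le> \<delta> / 4"
      using M Q by (simp add: field_simps)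
    hence "real N * (real (card (E4 \<inter> {..<M * Q})) / real (M * Q)) \<le> real N * (\<delta> / 4)"
      by (intro mult_left_mono) auto
    thus ?thesis using cnt_periodic[OF E4_per, of N] by (simp add: abs_le_iff mult.commute)
  qed
  \<comment> \<open>Four quarters of \<delta>: square divisors, large tails, near-one ratios, and
    all terms constant in N.\<close>
  have "eventually (\<lambda>N. real (cnt E N) \<le> \<delta> * real N) sequentially"
    using eventually_const_le_linear[of "\<delta> / 4" "1 / \<epsilon> + real (M * Q)"]
  proof (rule eventually_mono)
    fix N assume c: "1 / \<epsilon> + real (M * Q) \<le> \<delta> / 4 * real N"
    have "cnt E N \<le> cnt (E1 0) N + (cnt (E1 1) N + (cnt (E2 0) N + (cnt (E2 1) N + (cnt E3 N + cnt E4 N))))"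
      unfolding E_def by (intro order_trans[OF cnt_Un] add_left_mono order_refl)
    moreover have "31 / real z * real N + 31 / real z * real N \<le> \<delta> / 4 * real N"
      using mult_right_mono[OF zd, of "real N"] by simp
    moreover have "31 / (real y * \<epsilon>) * real N + 31 / (real y * \<epsilon>) * real N \<le> \<delta> / 4 * real N"
      using mult_right_mono[OF yd, of "real N"] by (simp add: mult.commute)
    ultimately show "real (cnt E N) \<le> \<delta> * real N"
      using c E1[of 0 N] E1[of 1 N] E2[of 0 N] E2[of 1 N] E3[of N] E4[of N] by linarith
  qed (use \<delta> in simp)
  thus "\<exists>L D E. periodic_set L D \<and> (\<forall>n\<ge>1. n \<notin> E \<longrightarrow> (n \<in> ?B \<longleftrightarrow> n \<in> D)) \<and>
      eventually (\<lambda>N. real (cnt E N) \<le> \<delta> * real N) sequentially"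
    using D_per BD by blast
qed


subsection \<open>The numerical bound\<close>

lemma card_one_residue_class_le:
  assumes "0 < m" "A \<subseteq> {1..N}" "\<And>k n. k \<in> A \<Longrightarrow> n \<in> A \<Longrightarrow> [k = n] (mod m)"
  shows "real (card A) \<le> real N / real m + 1"
proof -
  have "card A \<le> card {..N div m}"
  proof (rule card_inj_on_le[of "\<lambda>n. n div m"])
    show "inj_on (\<lambda>n. n div m) A"
    proof (rule inj_onI)
      fix k n assume kn: "k \<in> A" "n \<in> A" "k div m = n div m"
      hence "k mod m = n mod m" using assms(3)[OF kn(1,2)] by (simp only: unique_euclidean_semiring_class.cong_def)
      thus "k = n" using kn(3) by (metis div_mult_mod_eq)
    qed
    show "(\<lambda>n. n div m) ` A \<subseteq> {..N div m}" using assms(2) by (auto intro!: div_le_mono)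
  qed simp
  hence "real (card A) \<le> real (N div m) + 1" by simp
  also have "real (N div m) \<le> real N / real m" by (rule of_nat_div_le_of_nat)
  finally show ?thesis by simp
qed

text \<open>For d coprime to 30 the condition d | 30n + 1 fixes n modulo d, and d is odd, so with
  the parity n is fixed modulo 2d. Any other d never divides 30n + 1. The main term is sharp, at the
  price of an additive 1.\<close>

lemma card_parity_class_le:
  assumes "0 < d"
  shows "real (card {n\<in>{n\<in>{1..N}. n mod 2 = r}. d dvd 30 * n + 1})
    \<le> (if coprime d 30 then real N / (2 * real d) + 1 else 0)"
proof (cases "coprime d 30")
  case True
  let ?A = "{n\<in>{n\<in>{1..N}. n mod 2 = r}. d dvd 30 * n + 1}"
  have "coprime d (2 * 15)" using True by simp
  hence cop: "coprime 2 d" by (simp only: coprime_mult_right_iff coprime_commute)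
  have "real (card ?A) \<le> real N / real (2 * d) + 1"
  proof (rule card_one_residue_class_le)
    fix k n assume kn: "k \<in> ?A" "n \<in> ?A"
    have "[30 * k + 1 = 30 * n + 1] (mod d)"
      using kn by (auto simp: unique_euclidean_semiring_class.cong_def)
    hence "[30 * k = 30 * n] (mod d)" by (simp only: cong_add_rcancel_nat)
    hence "[k = n] (mod d)" using True by (simp add: cong_mult_lcancel_nat coprime_commute)
    moreover have "[k = n] (mod 2)" using kn by (simp add: unique_euclidean_semiring_class.cong_def)
    ultimately show "[k = n] (mod (2 * d))" using cop by (intro coprime_cong_mult_nat)
  qed (use assms in auto)
  thus ?thesis using True by simp
next
  case False
  have "\<not> d dvd 30 * n + 1" for n
  proof
    assume d: "d dvd 30 * n + 1"
    have "coprime (30 * n + 1) (30 * n)"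
      by (metis Suc_eq_plus1 coprime_Suc_left_nat)
    hence "coprime d 30" using d coprime_divisors dvd_triv_left by blast
    thus False using False by simp
  qed
  thus ?thesis using False by simp
qed

section \<open>The sum of inverse squares of integers coprime to 30\<close>

definition coprime_residues :: "nat set" where
  "coprime_residues = {1, 7, 11, 13, 17, 19, 23, 29}"

lemma mod_30_coprime:
  assumes "coprime (d::nat) 30"
  shows "d mod 30 \<in> coprime_residues"
proof -
  have ndvd: "\<not> q dvd d mod 30" if "q \<in> {2, 3, 5}" for q :: nat
  proof
    assume "q dvd d mod 30"
    moreover have "q dvd 30" using that by auto
    ultimately have "q dvd d" "q dvd 30" by (simp_all add: dvd_mod_iff)
    hence "q dvd 1" using assms coprime_common_divisor by blast
    thus False using that by auto
  qed
  have "\<not> 2 dvd d mod 30" "\<not> 3 dvd d mod 30" "\<not> 5 dvd d mod 30"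
    by (rule ndvd, simp)+
  moreover have "d mod 30 \<in> set [0..<30]" by simp
  moreover have "\<forall>r\<in>set [0..<30]. \<not> 2 dvd r \<longrightarrow> \<not> 3 dvd r \<longrightarrow> \<not> 5 dvd r \<longrightarrow> r \<in> coprime_residues"
    unfolding coprime_residues_def by code_simp
  ultimately show ?thesis by blast
qed

text \<open>The terms below 60 are summed explicitly. Each later block from 30K to 30K + 29 has at
  most 8 terms of size at most 1/(30K)^2, and 1/K^2 \<le> 1/(K - 1) - 1/K telescopes.\<close>

lemma sum_coprime_inverse_squares:
  assumes "2 \<le> K"
  shows "(\<Sum>d | d \<in> {2..<30 * K} \<and> coprime d 30. 1 / (real d)\<^sup>2) \<le> 4832 / 100000 + 8 / 900 * (1 - 1 / (real K - 1))"
  using assms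
proof (induction K rule: dec_induct)
  case base
  let ?S = "{7, 11, 13, 17, 19, 23, 29, 31, 37, 41, 43, 47, 49, 53, 59} :: nat set"
  have "{d. d \<in> {2..<30 * 2} \<and> coprime d 30} \<subseteq> ?S"
  proof
    fix d :: nat assume d: "d \<in> {d. d \<in> {2..<30 * 2} \<and> coprime d 30}"
    hence "d mod 30 \<in> coprime_residues" by (auto intro: mod_30_coprime)
    moreover have "d = 30 * (d div 30) + d mod 30" by simp
    moreover have "d div 30 = 0 \<or> d div 30 = 1" using d by auto
    ultimately obtain q r where "d = 30 * q + r" "q = 0 \<or> q = 1" "r \<in> coprime_residues" by blast
    moreover have "d \<noteq> 1" using d by auto
    ultimately show "d \<in> ?S" unfolding coprime_residues_def by auto
  qed
  hence "(\<Sum>d | d \<in> {2..<30 * 2} \<and> coprime d 30. 1 / (real d)\<^sup>2) \<le> (\<Sum>d\<in>?S. 1 / (real d)\<^sup>2)"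
    by (intro sum_mono2) auto
  also have "\<dots> \<le> 4832 / 100000" by simp
  finally show ?case by simp
next
  case (step K)
  let ?B = "{d. d \<in> {30 * K..<30 * Suc K} \<and> coprime d 30}"
  have "?B \<subseteq> (\<lambda>r. 30 * K + r) ` coprime_residues"
  proof
    fix d assume d: "d \<in> ?B"
    hence "d div 30 = K" by auto
    hence "d = 30 * K + d mod 30" by (metis mult_div_mod_eq)
    thus "d \<in> (\<lambda>r. 30 * K + r) ` coprime_residues" using d mod_30_coprime by blast
  qed
  hence "card ?B \<le> card ((\<lambda>r. 30 * K + r) ` coprime_residues)"
    by (intro card_mono) (auto simp: coprime_residues_def)
  also have "\<dots> \<le> card coprime_residues"
    by (intro card_image_le) (simp add: coprime_residues_def)
  finally have "card ?B \<le> card coprime_residues" .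
  hence card: "card ?B \<le> 8" by (simp add: coprime_residues_def)
  have K: "1 < real K" using step by simp
  have "(\<Sum>d\<in>?B. 1 / (real d)\<^sup>2) \<le> real (card ?B) * (1 / (30 * real K)\<^sup>2)"
  proof (rule sum_bounded_above)
    fix d assume "d \<in> ?B"
    hence "30 * real K \<le> real d" by auto
    thus "1 / (real d)\<^sup>2 \<le> 1 / (30 * real K)\<^sup>2"
      using K by (intro divide_left_mono power_mono) auto
  qed
  also have "\<dots> \<le> 8 * (1 / (30 * real K)\<^sup>2)" using card by (intro mult_right_mono) auto
  also have "\<dots> = 8 / 900 * (1 / (real K)\<^sup>2)" by (simp add: power_mult_distrib)
  also have "1 / (real K)\<^sup>2 \<le> 1 / (real K * (real K - 1))"
    using K by (intro divide_left_mono) (auto simp: power2_eq_square)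
  also have "1 / (real K * (real K - 1)) = 1 / (real K - 1) - 1 / real K"
    using K by (simp add: field_simps)
  finally have B: "(\<Sum>d\<in>?B. 1 / (real d)\<^sup>2) \<le> 8 / 900 * (1 / (real K - 1) - 1 / real K)" by simp
  have "{d. d \<in> {2..<30 * Suc K} \<and> coprime d 30} = {d. d \<in> {2..<30 * K} \<and> coprime d 30} \<union> ?B"
    using step by auto
  hence "(\<Sum>d | d \<in> {2..<30 * Suc K} \<and> coprime d 30. 1 / (real d)\<^sup>2)
    = (\<Sum>d | d \<in> {2..<30 * K} \<and> coprime d 30. 1 / (real d)\<^sup>2) + (\<Sum>d\<in>?B. 1 / (real d)\<^sup>2)"
    by (simp add: sum.union_disjoint disjoint_iff)
  also have "\<dots> \<le> (4832 / 100000 + 8 / 900 * (1 - 1 / (real K - 1))) + 8 / 900 * (1 / (real K - 1) - 1 / real K)"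
    by (rule add_mono[OF step.IH B])
  also have "\<dots> = 4832 / 100000 + 8 / 900 * (1 - 1 / real K)"
    by (simp only: add.assoc distrib_left[symmetric]) simp
  finally show ?case by simp
qed

lemma sum_coprime_inverse_squares_le:
  "(\<Sum>d\<in>{2..K}. if coprime d 30 then 1 / (real d)\<^sup>2 else 0) \<le> 573 / 10000"
proof -
  have "(\<Sum>d\<in>{2..K}. if coprime d 30 then 1 / (real d)\<^sup>2 else 0)
      = (\<Sum>d | d \<in> {2..K} \<and> coprime d 30. 1 / (real d)\<^sup>2)"
    by (simp add: sum.inter_filter[symmetric])
  also have "\<dots> \<le> (\<Sum>d | d \<in> {2..<30 * (K + 2)} \<and> coprime d 30. 1 / (real d)\<^sup>2)"
    by (intro sum_mono2) auto
  also have "\<dots> \<le> 4832 / 100000 + 8 / 900 * (1 - 1 / (real (K + 2) - 1))"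
    by (rule sum_coprime_inverse_squares) simp
  also have "\<dots> \<le> 573 / 10000"
  proof -
    have le: "4832 / 100000 + 8 / 900 * (1 - x) \<le> 573 / 10000" if "0 \<le> x" for x :: real
      using that by (simp add: field_simps)
    show ?thesis by (rule le) simp
  qed
  finally show ?thesis .
qed

text \<open>The divisors are split at \<open>Y\<close>: up to \<open>Y\<close> the sharp density
  1/(2d) is used, with total additive error at most \<open>Y\<close>; beyond it the crude bound
  without additive error suffices. The main constant is half of 0.0573.\<close>

lemma sum_tail_parity_class_le:
  assumes "0 < Y"
  shows "(\<Sum>n\<in>{n\<in>{1..N}. n mod 2 = r}. abundancy_tail 1 (30 * n + 1))
    \<le> (2865 / 100000 + 31 / real Y) * real N + real Y"
proof -
  let ?A = "{n\<in>{1..N}. n mod 2 = r}"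
  define c where "c d = real (card {n\<in>?A. d dvd 30 * n + 1})" for d
  have c0: "0 \<le> c d" for d by (simp add: c_def)
  have c1: "1 / real d * c d \<le> real N / 2 * (if coprime d 30 then 1 / (real d)\<^sup>2 else 0) + 1" if "0 < d" for d
  proof -
    have "1 / real d * c d \<le> 1 / real d * (if coprime d 30 then real N / (2 * real d) + 1 else 0)"
      unfolding c_def using that by (intro mult_left_mono card_parity_class_le) auto
    also have "\<dots> \<le> real N / 2 * (if coprime d 30 then 1 / (real d)\<^sup>2 else 0) + 1"
      using that by (auto simp: field_simps power2_eq_square)
    finally show ?thesis .
  qed
  have c2: "1 / real d * c d \<le> 31 * real N * (1 / (real d)\<^sup>2)" if "0 < d" for d
  proof -
    have "card {n\<in>?A. d dvd 30 * n + 1} \<le> card {n\<in>{1..N}. d dvd 30 * n + 1}"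
      by (intro card_mono) auto
    hence "c d \<le> 31 * real N / real d"
      unfolding c_def using card_dvd_linear_le[OF that, of 1 N] by linarith
    hence "1 / real d * c d \<le> 1 / real d * (31 * real N / real d)" by (intro mult_left_mono) auto
    thus ?thesis by (simp add: power2_eq_square)
  qed
  have "(\<Sum>n\<in>?A. abundancy_tail 1 (30 * n + 1)) = (\<Sum>d\<in>{2..31*N}. 1 / real d * c d)"
    unfolding c_def one_add_one[symmetric] by (rule sum_abundancy_tail) auto
  \<comment> \<open>An inequality, since \<open>Y\<close> may exceed \<open>31*N\<close>.\<close>
  also have "\<dots> \<le> (\<Sum>d\<in>{2..Y} \<union> {Y+1..31*N}. 1 / real d * c d)"
    using c0 by (intro sum_mono2) auto
  also have "\<dots> = (\<Sum>d\<in>{2..Y}. 1 / real d * c d) + (\<Sum>d\<in>{Y+1..31*N}. 1 / real d * c d)"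
    by (intro sum.union_disjoint) auto
  also have "\<dots> \<le> (\<Sum>d\<in>{2..Y}. real N / 2 * (if coprime d 30 then 1 / (real d)\<^sup>2 else 0) + 1)
      + (\<Sum>d\<in>{Y+1..31*N}. 31 * real N * (1 / (real d)\<^sup>2))"
    by (intro add_mono sum_mono c1 c2) auto
  also have "\<dots> = real N / 2 * (\<Sum>d\<in>{2..Y}. if coprime d 30 then 1 / (real d)\<^sup>2 else 0) + real (card {2..Y})
      + 31 * real N * (\<Sum>d\<in>{Y+1..31*N}. 1 / (real d)\<^sup>2)"
    by (simp only: sum.distrib sum_distrib_left[symmetric]) simp
  also have "\<dots> \<le> real N / 2 * (573 / 10000) + real Y + 31 * real N * (1 / real Y)"
    by (intro add_mono mult_left_mono sum_coprime_inverse_squares_le sum_inverse_square_tail assms) auto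
  finally show ?thesis by (simp add: algebra_simps)
qed

section \<open>Lower bounds on B and the final count\<close>

lemma divisor_sum_filter:
  assumes "0 < m"
  shows "divisor_sum m = sum_list (filter (\<lambda>d. d dvd m) [0..<Suc m])"
proof -
  have "{d. d dvd m} = set (filter (\<lambda>d. d dvd m) [0..<Suc m])"
    using assms by (auto dest: dvd_imp_le simp del: upt_Suc simp: less_Suc_eq_le)
  thus ?thesis unfolding divisor_sum_def
    by (simp only: sum.distinct_set_conv_list[OF distinct_filter[OF distinct_upt]] list.map_ident)
qed

lemma divisor_sum_30: "divisor_sum 30 = 72"
proof -
  have "sum_list (filter (\<lambda>d. d dvd 30) [0..<Suc 30]) = (72 :: nat)" by code_simp
  thus ?thesis by (simp only: divisor_sum_filter zero_less_numeral)
qed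

lemma divisor_sum_60: "divisor_sum 60 = 168"
proof -
  have "sum_list (filter (\<lambda>d. d dvd 60) [0..<Suc 60]) = (168 :: nat)" by code_simp
  thus ?thesis by (simp only: divisor_sum_filter zero_less_numeral)
qed

text \<open>The constants lie 0.01 below h(30) - 1 = 7/5 and h(60) - 1 = 9/5; for n \<ge> 10 this
  slack absorbs the factor 30n/(30n + 1).\<close>

lemma abundancy_tail_lower:
  assumes n: "10 \<le> n" and ge: "divisor_sum (30 * n + 1) \<ge> divisor_sum (30 * n)"
  shows "139 / 100 \<le> abundancy_tail 1 (30 * n + 1)"
    and "even n \<Longrightarrow> 179 / 100 \<le> abundancy_tail 1 (30 * n + 1)"
proof -
  define T where "T = abundancy_tail 1 (30 * n + 1)"
  have n': "10 \<le> real n" using n by simp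
  have eq: "real (divisor_sum (30 * n + 1)) = (1 + T) * (30 * real n + 1)"
    using divisor_sum_abundancy[of "30 * n + 1"] abundancy_eq_tail[of "30 * n + 1"]
    by (simp add: T_def mult.commute)
  have conclude: "c \<le> T" if "(1 + c) * (30 * real n + 1) \<le> real (divisor_sum (30 * n))" for c
  proof -
    have "(1 + c) * (30 * real n + 1) \<le> (1 + T) * (30 * real n + 1)"
      using that ge eq by linarith
    hence "1 + c \<le> 1 + T" by (rule mult_right_le_imp_le) (use n' in simp)
    thus ?thesis by simp
  qed
  have "72 * n \<le> divisor_sum (30 * n)"
    using divisor_sum_mult_ge[of 30 n] n by (simp add: divisor_sum_30)
  hence "72 * real n \<le> real (divisor_sum (30 * n))" by linarith
  moreover have "(1 + 139 / 100) * (30 * real n + 1) = 717 / 10 * real n + 239 / 100" by simp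
  ultimately have "139 / 100 \<le> T" using n' by (intro conclude) linarith
  thus "139 / 100 \<le> abundancy_tail 1 (30 * n + 1)" by (simp add: T_def)
  assume "even n"
  then obtain k where k: "n = 2 * k" by blast
  have "168 * k \<le> divisor_sum (30 * n)"
    using divisor_sum_mult_ge[of 60 k] n k by (simp add: divisor_sum_60)
  hence "84 * real n \<le> real (divisor_sum (30 * n))" using k by linarith
  moreover have "(1 + 179 / 100) * (30 * real n + 1) = 837 / 10 * real n + 279 / 100" by simp
  ultimately have "179 / 100 \<le> T" using n' by (intro conclude) linarith
  thus "179 / 100 \<le> abundancy_tail 1 (30 * n + 1)" by (simp add: T_def)
qed

lemma cnt_divisor_sum_le:
  fixes N :: nat
  defines "B \<equiv> {n. 1 \<le> n \<and> divisor_sum (30 * n + 1) \<ge> divisor_sum (30 * n)}"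
  shows "real (cnt B N) \<le> 37 / 1000 * real N + 1000000"
proof -
  define A where "A r = {n\<in>{1..N}. n mod 2 = r}" for r
  define T where "T n = abundancy_tail 1 (30 * n + 1)" for n
  have T0: "0 \<le> T n" for n by (simp add: T_def abundancy_tail_nonneg)
  have markov: "c * real (card {n \<in> B \<inter> A r. 10 \<le> n}) \<le> 28806 / 1000000 * real N + 200000"
    if c: "\<And>n. n \<in> B \<inter> A r \<Longrightarrow> 10 \<le> n \<Longrightarrow> c \<le> T n" for c r
  proof -
    have "c * real (card {n \<in> B \<inter> A r. 10 \<le> n}) = (\<Sum>n | n \<in> B \<inter> A r \<and> 10 \<le> n. c)" by simp
    also have "\<dots> \<le> (\<Sum>n | n \<in> B \<inter> A r \<and> 10 \<le> n. T n)" using c by (intro sum_mono) auto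
    also have "\<dots> \<le> (\<Sum>n\<in>A r. T n)" using T0 by (intro sum_mono2) (auto simp: A_def)
    \<comment> \<open>With Y = 200000 the term 31/Y is 0.000155.\<close>
    also have "\<dots> \<le> (2865 / 100000 + 31 / real 200000) * real N + real 200000"
      unfolding T_def A_def by (rule sum_tail_parity_class_le) simp
    also have "\<dots> \<le> 28806 / 1000000 * real N + 200000" by simp
    finally show ?thesis .
  qed
  have odd: "139 / 100 * real (card {n \<in> B \<inter> A 1. 10 \<le> n}) \<le> 28806 / 1000000 * real N + 200000"
    by (rule markov) (unfold B_def T_def, blast intro: abundancy_tail_lower(1))
  have even: "179 / 100 * real (card {n \<in> B \<inter> A 0. 10 \<le> n}) \<le> 28806 / 1000000 * real N + 200000"
  proof (rule markov)
    fix n assume n: "n \<in> B \<inter> A 0" "10 \<le> n"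
    hence "even n" by (auto simp: A_def)
    thus "179 / 100 \<le> T n" unfolding T_def using n by (intro abundancy_tail_lower(2)) (auto simp: B_def)
  qed
  have "B \<inter> {1..N} \<subseteq> {..<10} \<union> ({n \<in> B \<inter> A 1. 10 \<le> n} \<union> {n \<in> B \<inter> A 0. 10 \<le> n})"
    by (auto simp: A_def)
  hence "cnt B N \<le> card ({..<10} \<union> ({n \<in> B \<inter> A 1. 10 \<le> n} \<union> {n \<in> B \<inter> A 0. 10 \<le> n}))"
    unfolding cnt_def by (intro card_mono) (auto simp: A_def)
  also have "\<dots> \<le> card {..<10::nat} + (card {n \<in> B \<inter> A 1. 10 \<le> n} + card {n \<in> B \<inter> A 0. 10 \<le> n})"
    by (intro order_trans[OF card_Un_le] add_left_mono card_Un_le)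
  finally have "real (cnt B N) \<le> 10 + (real (card {n \<in> B \<inter> A 1. 10 \<le> n}) + real (card {n \<in> B \<inter> A 0. 10 \<le> n}))"
    by simp
  \<comment> \<open>0.028806 (1/1.39 + 1/1.79) is about 0.03682, below 0.037.\<close>
  thus ?thesis using odd even by (simp add: field_simps)
qed

theorem theorem2:
  fixes B :: "nat set"
  defines "B \<equiv> {n. 1 \<le> n \<and> divisor_sum (30 * n + 1) \<ge> divisor_sum (30 * n)}"
  shows "\<exists>\<delta>::real. has_natural_density B \<delta> \<and> \<delta> < 0.0371813"
proof -
  obtain \<delta> where lim: "(\<lambda>N. real (cnt B N) / real N) \<longlonglongrightarrow> \<delta>"
    using convergent_cnt_divisor_sum unfolding B_def convergent_def by blast
  \<comment> \<open>The additive constant costs 0.0001, giving 0.0371, still below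
    0.0371813.\<close>
  have "eventually (\<lambda>N::nat. 1000000 \<le> 1 / 10000 * real N) sequentially"
    by (rule eventually_const_le_linear) simp
  hence "eventually (\<lambda>N. real (cnt B N) / real N \<le> 371 / 10000) sequentially"
    using eventually_gt_at_top[of 0]
  proof eventually_elim
    case (elim N)
    have "real (cnt B N) \<le> 371 / 10000 * real N"
      using cnt_divisor_sum_le[of N] elim unfolding B_def by linarith
    thus ?case using elim by (simp add: divide_le_eq)
  qed
  hence "\<delta> \<le> 371 / 10000" using lim by (intro tendsto_upperbound) auto
  moreover have "has_natural_density B \<delta>" by (rule has_natural_density_cnt[OF lim])
  ultimately show ?thesis by force
qed

end
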